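(* Let $\mathcal{C}$ be a Cauchy complete $*$-autonomous category (not assumed symmetric) equipped with a right $\otimes$-trace and a left $\otimes$-trace. Let $\Theta$ and $\Theta'$ be the operations constructed from these traces (defined in the context), where $$\Theta(f,g)\colon A⅋B\to C\otimes D\quad\text{for } f\colon A⅋X\to C,\ g\colon B\to X\otimes D,$$ $$\Theta'(f,g)\colon B⅋A\to D\otimes C\quad\text{for } f\colon X⅋A\to C,\ g\colon B\to D\otimes X .$$ Suppose that the following two equations hold: ($\varepsilon_\otimes$-sup) for all $k\colon A\to C$, $g\colon B\to P\otimes Q$, $h\colon P\otimes Q\to D$, $$(C⅋h)\circ\delta_R\circ\Theta(k⅋P,\,g)=k⅋(h\circ g)\colon A⅋B\to C⅋D,$$ where $\delta_R\colon(C⅋P)\otimes Q\to C⅋(P\otimes Q)$; ($\varepsilon_⅋$-sup) for all $k\colon B\to D$, $p\colon E\to P⅋Q$, $q\colon P⅋Q\to C$, $$\Theta(q,\,Q\otimes k)\circ\delta_R\circ(p\otimes B)=(q\circ p)\otimes k\colon E\otimes B\to C\otimes D,$$ where $\delta_R\colon(P⅋Q)\otimes B\to P⅋(Q\otimes B)$ and $Q\otimes k\colon Q\otimes B\to Q\otimes D$; and suppose that their left-right symmetric analogues hold: (i) for all $k\colon A\to C$, $g\colon B\to Q\otimes P$, $h\colon Q\otimes P\to D$, $$(h⅋C)\circ\delta_L\circ\Theta'(P⅋k,\,g)=(h\circ g)⅋k\colon B⅋A\to D⅋C,$$ where $\delta_L\colon Q\otimes(P⅋C)\to(Q\otimes P)⅋C$;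 (ii) for all $k\colon B\to D$, $p\colon E\to Q⅋P$, $q\colon Q⅋P\to C$, $$\Theta'(q,\,k\otimes Q)\circ\delta_L\circ(B\otimes p)=k\otimes(q\circ p)\colon B\otimes E\to D\otimes C,$$ where $\delta_L\colon B\otimes(Q⅋P)\to(B\otimes Q)⅋P$ and $k\otimes Q\colon B\otimes Q\to D\otimes Q$. Then $\mathcal{C}$ is autonomous, i.e. every object of the monoidal category $(\mathcal{C},\otimes,I)$ has a left dual and a right dual.
   Context: Categories are small; Cauchy complete means that all idempotents split. Associativity and unit isomorphisms of $\otimes$ and $⅋$ are suppressed where evident. **$*$-autonomous category (non-symmetric).** A monoidal category $(\mathcal{C},\otimes,I)$ with an object $\bot$ such that every object $A$ has objects $A^\bot$, ${}^\bot A$ with natural bijections $\mathcal{C}(X,A^\bot)\cong\mathcal{C}(A\otimes X,\bot)$ and $\mathcal{C}(X,{}^\bot A)\cong\mathcal{C}(X\otimes A,\bot)$, and such that the canonical maps $A\to{}^\bot(A^\bot)$ and $A\to({}^\bot A)^\bot$ are isomorphisms. Put $A⅋B:={}^\bot(B^\bot\otimes A^\bot)\cong({}^\bot B\otimes{}^\bot A)^\bot$; then $(\mathcal{C},⅋,\bot)$ is a monoidal category, $(A⅋B)^\bot\cong B^\bot\otimes A^\bot$, ${}^\bot(A⅋B)\cong{}^\bot B\otimes{}^\bot A$, and there are natural bijections $$\mathcal{C}(A\otimes Y,M)\cong\mathcal{C}(A,M⅋{}^\bot Y),\qquad \mathcal{C}(Y\otimes A,M)\cong\mathcal{C}(A,Y^\bot⅋M).$$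 In particular there are canonical maps $I\to D⅋{}^\bot D$, $I\to D^\bot⅋D$, ${}^\bot D\otimes D\to\bot$, $D\otimes D^\bot\to\bot$. **Linear distributors.** $\delta_L\colon A\otimes(B⅋C)\to(A\otimes B)⅋C$ is the transpose, under the first bijection with $Y=C^\bot$, of $A\otimes(B⅋C)\otimes C^\bot\to A\otimes B$ induced by the counit $(B⅋C)\otimes C^\bot\to B$. Likewise $\delta_R\colon(A⅋B)\otimes C\to A⅋(B\otimes C)$ is the transpose, under the second bijection with $Y={}^\bot A$, of ${}^\bot A\otimes(A⅋B)\otimes C\to B\otimes C$ induced by the counit ${}^\bot A\otimes(A⅋B)\to B$. **Traces.** A right trace on a monoidal category $(\mathcal{C},\boxdot,J,\alpha,\lambda,\rho)$ is a family of functions $\mathrm{Tr}^X_{A,B}\colon\mathcal{C}(A\boxdot X,B\boxdot X)\to\mathcal{C}(A,B)$ satisfying: * tightening: $\mathrm{Tr}^X((h\boxdot X)\circ f\circ(g\boxdot X))=h\circ\mathrm{Tr}^X(f)\circ g$; * sliding: $\mathrm{Tr}^X((B\boxdot h)\circ f)=\mathrm{Tr}^Y(f\circ(A\boxdot h))$ for $f\colon A\boxdot X\to B\boxdot Y$, $h\colon Y\to X$; * vanishing: $\mathrm{Tr}^J(f)=\rho_B f\rho_A^{-1}$ and $\mathrm{Tr}^{X\boxdot Y}(f)=\mathrm{Tr}^X(\mathrm{Tr}^Y(\alpha^{-1}_{B,X,Y} f\alpha_{A,X,Y}))$; * superposing: $\mathrm{Tr}^X(\alpha^{-1}_{D,B,X}(g\boxdot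 f)\alpha_{C,A,X})=g\boxdot\mathrm{Tr}^X(f)$ for $g\colon C\to D$, $f\colon A\boxdot X\to B\boxdot X$. A left trace is a family $\mathcal{C}(X\boxdot A,X\boxdot B)\to\mathcal{C}(A,B)$ satisfying the mirror-image axioms (a right trace for the reversed product). Write $\otimes\mathsf{Tr}_R$, $\otimes\mathsf{Tr}_L$ for the given right and left $\otimes$-traces. Through duality they induce $⅋$-traces: * a right $⅋$-trace $⅋\mathsf{Tr}_R^{Z}\colon\mathcal{C}(E⅋Z,R⅋Z)\to\mathcal{C}(E,R)$, where $⅋\mathsf{Tr}_R^Z(f)$ is the unique map whose image under $(-)^\bot$ is $\otimes\mathsf{Tr}_L^{Z^\bot}$ of $f^\bot\colon Z^\bot\otimes R^\bot\to Z^\bot\otimes E^\bot$; * a left $⅋$-trace $⅋\mathsf{Tr}_L^{Z}\colon\mathcal{C}(Z⅋E,Z⅋R)\to\mathcal{C}(E,R)$, where $⅋\mathsf{Tr}_L^Z(f)$ is the unique map whose image under ${}^\bot(-)$ is $\otimes\mathsf{Tr}_R^{{}^\bot Z}$ of ${}^\bot f\colon{}^\bot R\otimes{}^\bot Z\to{}^\bot E\otimes{}^\bot Z$. **The operation $\Theta$ (the white "Frobenius" $2$-morphism).** Given $f\colon A⅋X\to C$ and $g\colon B\to X\otimes D$, first let $$t:=\otimes\mathsf{Tr}_R^{D}\Big((B⅋{}^\bot D)\otimes D\xrightarrow{(g⅋{}^\bot D)\otimes D}((X\otimes D)⅋{}^\bot D)\otimes D\xrightarrow{\delta_R}(X\otimes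 D)⅋({}^\bot D\otimes D)\to(X\otimes D)⅋\bot\cong X\otimes D\Big)\colon B⅋{}^\bot D\to X,$$ and then $$\Theta(f,g):=⅋\mathsf{Tr}_R^{{}^\bot D}\Big((A⅋B)⅋{}^\bot D\cong A⅋(B⅋{}^\bot D)\xrightarrow{A⅋t}A⅋X\xrightarrow{f}C\cong C\otimes I\to C\otimes(D⅋{}^\bot D)\xrightarrow{\delta_L}(C\otimes D)⅋{}^\bot D\Big)\colon A⅋B\to C\otimes D.$$ **The operation $\Theta'$ (its left-right mirror image).** Given $f\colon X⅋A\to C$ and $g\colon B\to D\otimes X$, let $$t':=\otimes\mathsf{Tr}_L^{D}\Big(D\otimes(D^\bot⅋B)\xrightarrow{D\otimes(D^\bot⅋g)}D\otimes(D^\bot⅋(D\otimes X))\xrightarrow{\delta_L}(D\otimes D^\bot)⅋(D\otimes X)\to\bot⅋(D\otimes X)\cong D\otimes X\Big)\colon D^\bot⅋B\to X,$$ $$\Theta'(f,g):=⅋\mathsf{Tr}_L^{D^\bot}\Big(D^\bot⅋(B⅋A)\cong(D^\bot⅋B)⅋A\xrightarrow{t'⅋A}X⅋A\xrightarrow{f}C\cong I\otimes C\to(D^\bot⅋D)\otimes C\xrightarrow{\delta_R}D^\bot⅋(D\otimes C)\Big)\colon B⅋A\to D\otimes C.$$ *)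

theory Defs
  imports Main
begin

section \<open>Categories\<close>

record ('o, 'm) category_data =
  Ob :: "'o set"
  Arr :: "'m set"
  Dom :: "'m \<Rightarrow> 'o"
  Cod :: "'m \<Rightarrow> 'o"
  ident :: "'o \<Rightarrow> 'm" (\<open>\<one>\<index>\<close>)
  comp :: "'m \<Rightarrow> 'm \<Rightarrow> 'm" (infixl \<open>\<cdot>\<index>\<close> 55)

definition hom :: "('o, 'm, 'z) category_data_scheme \<Rightarrow> 'o \<Rightarrow> 'o \<Rightarrow> 'm set" where
  "hom \<C> A B = {f \<in> Arr \<C>. Dom \<C> f = A \<and> Cod \<C> f = B}"

locale category =
  fixes \<C> :: "('o, 'm, 'z) category_data_scheme" (structure)
  assumes Dom_in_Ob: "f \<in> Arr \<C> \<Longrightarrow> Dom \<C> f \<in> Ob \<C>"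
    and Cod_in_Ob: "f \<in> Arr \<C> \<Longrightarrow> Cod \<C> f \<in> Ob \<C>"
    and ident_in_hom: "A \<in> Ob \<C> \<Longrightarrow> \<one> A \<in> hom \<C> A A"
    and comp_in_hom: "f \<in> hom \<C> A B \<Longrightarrow> g \<in> hom \<C> B C \<Longrightarrow> g \<cdot> f \<in> hom \<C> A C"
    and comp_ident_left: "f \<in> hom \<C> A B \<Longrightarrow> \<one> B \<cdot> f = f"
    and comp_ident_right: "f \<in> hom \<C> A B \<Longrightarrow> f \<cdot> \<one> A = f"
    and comp_assoc: "f \<in> hom \<C> A B \<Longrightarrow> g \<in> hom \<C> B C \<Longrightarrow> h \<in> hom \<C> C D \<Longrightarrow>
      (h \<cdot> g) \<cdot> f = h \<cdot> (g \<cdot> f)"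

definition inverse_arrows :: "('o, 'm, 'z) category_data_scheme \<Rightarrow> 'm \<Rightarrow> 'm \<Rightarrow> bool" where
  "inverse_arrows \<C> f g \<longleftrightarrow> g \<in> hom \<C> (Cod \<C> f) (Dom \<C> f) \<and>
    g \<cdot> f = \<one> (Dom \<C> f) \<and> f \<cdot> g = \<one> (Cod \<C> f)" for \<C> (structure)

definition iso_arrow :: "('o, 'm, 'z) category_data_scheme \<Rightarrow> 'm \<Rightarrow> bool" where
  "iso_arrow \<C> f \<longleftrightarrow> f \<in> Arr \<C> \<and> (\<exists>g. inverse_arrows \<C> f g)"

definition inverse_arrow :: "('o, 'm, 'z) category_data_scheme \<Rightarrow> 'm \<Rightarrow> 'm"
    (\<open>inv\<index> _\<close> [81] 80) where
  "inv\<^bsub>\<C>\<^esub> f = (THE g. inverse_arrows \<C> f g)"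

definition cauchy_complete :: "('o, 'm, 'z) category_data_scheme \<Rightarrow> bool" where
  "cauchy_complete \<C> \<longleftrightarrow> (\<forall>A \<in> Ob \<C>. \<forall>e \<in> hom \<C> A A. e \<cdot> e = e \<longrightarrow>
    (\<exists>B \<in> Ob \<C>. \<exists>r \<in> hom \<C> A B. \<exists>s \<in> hom \<C> B A. s \<cdot> r = e \<and> r \<cdot> s = \<one> B))"
  for \<C> (structure)


section \<open>Monoidal categories\<close>

record ('o, 'm) monoidal_data = "('o, 'm) category_data" +
  tensor_ob :: "'o \<Rightarrow> 'o \<Rightarrow> 'o" (infixr \<open>\<otimes>\<index>\<close> 70)
  tensor_arr :: "'m \<Rightarrow> 'm \<Rightarrow> 'm" (infixr \<open>\<otimes>\<^sub>a\<index>\<close> 70)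
  unit_ob :: 'o (\<open>\<I>\<index>\<close>)
  assoc :: "'o \<Rightarrow> 'o \<Rightarrow> 'o \<Rightarrow> 'm"
  lunit :: "'o \<Rightarrow> 'm"
  runit :: "'o \<Rightarrow> 'm"

locale monoidal_category = category \<C>
  for \<C> :: "('o, 'm, 'z) monoidal_data_scheme" (structure) +
  assumes tensor_ob_in_Ob: "A \<in> Ob \<C> \<Longrightarrow> B \<in> Ob \<C> \<Longrightarrow> A \<otimes> B \<in> Ob \<C>"
    and unit_in_Ob: "\<I> \<in> Ob \<C>"
    and tensor_arr_in_hom: "f \<in> hom \<C> A B \<Longrightarrow> g \<in> hom \<C> C D \<Longrightarrow>
      f \<otimes>\<^sub>a g \<in> hom \<C> (A \<otimes> C) (B \<otimes> D)"
    and tensor_ident: "A \<in> Ob \<C> \<Longrightarrow> B \<in> Ob \<C> \<Longrightarrow> \<one> A \<otimes>\<^sub>a \<one> B = \<one> (A \<otimes> B)"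
    and tensor_comp: "f \<in> hom \<C> A B \<Longrightarrow> g \<in> hom \<C> B C \<Longrightarrow>
      f' \<in> hom \<C> A' B' \<Longrightarrow> g' \<in> hom \<C> B' C' \<Longrightarrow>
      (g \<cdot> f) \<otimes>\<^sub>a (g' \<cdot> f') = (g \<otimes>\<^sub>a g') \<cdot> (f \<otimes>\<^sub>a f')"
    and assoc_in_hom: "A \<in> Ob \<C> \<Longrightarrow> B \<in> Ob \<C> \<Longrightarrow> C \<in> Ob \<C> \<Longrightarrow>
      assoc \<C> A B C \<in> hom \<C> ((A \<otimes> B) \<otimes> C) (A \<otimes> (B \<otimes> C))"
    and assoc_iso: "A \<in> Ob \<C> \<Longrightarrow> B \<in> Ob \<C> \<Longrightarrow> C \<in> Ob \<C> \<Longrightarrow> iso_arrow \<C> (assoc \<C> A B C)"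
    and assoc_natural: "f \<in> hom \<C> A A' \<Longrightarrow> g \<in> hom \<C> B B' \<Longrightarrow> h \<in> hom \<C> C C' \<Longrightarrow>
      assoc \<C> A' B' C' \<cdot> ((f \<otimes>\<^sub>a g) \<otimes>\<^sub>a h) = (f \<otimes>\<^sub>a (g \<otimes>\<^sub>a h)) \<cdot> assoc \<C> A B C"
    and lunit_in_hom: "A \<in> Ob \<C> \<Longrightarrow> lunit \<C> A \<in> hom \<C> (\<I> \<otimes> A) A"
    and lunit_iso: "A \<in> Ob \<C> \<Longrightarrow> iso_arrow \<C> (lunit \<C> A)"
    and lunit_natural: "f \<in> hom \<C> A B \<Longrightarrow> lunit \<C> B \<cdot> (\<one> \<I> \<otimes>\<^sub>a f) = f \<cdot> lunit \<C> A"
    and runit_in_hom: "A \<in> Ob \<C> \<Longrightarrow> runit \<C> A \<in> hom \<C> (A \<otimes> \<I>) A"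
    and runit_iso: "A \<in> Ob \<C> \<Longrightarrow> iso_arrow \<C> (runit \<C> A)"
    and runit_natural: "f \<in> hom \<C> A B \<Longrightarrow> runit \<C> B \<cdot> (f \<otimes>\<^sub>a \<one> \<I>) = f \<cdot> runit \<C> A"
    and pentagon: "A \<in> Ob \<C> \<Longrightarrow> B \<in> Ob \<C> \<Longrightarrow> C \<in> Ob \<C> \<Longrightarrow> D \<in> Ob \<C> \<Longrightarrow>
      (\<one> A \<otimes>\<^sub>a assoc \<C> B C D) \<cdot> assoc \<C> A (B \<otimes> C) D \<cdot> (assoc \<C> A B C \<otimes>\<^sub>a \<one> D)
        = assoc \<C> A B (C \<otimes> D) \<cdot> assoc \<C> (A \<otimes> B) C D"
    and triangle: "A \<in> Ob \<C> \<Longrightarrow> B \<in> Ob \<C> \<Longrightarrow>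
      (\<one> A \<otimes>\<^sub>a lunit \<C> B) \<cdot> assoc \<C> A \<I> B = runit \<C> A \<otimes>\<^sub>a \<one> B"

definition reversed :: "('o, 'm, 'z) monoidal_data_scheme \<Rightarrow> ('o, 'm, 'z) monoidal_data_scheme"
  where
  "reversed \<C> = \<C>\<lparr>
    tensor_ob := (\<lambda>A B. B \<otimes> A),
    tensor_arr := (\<lambda>f g. g \<otimes>\<^sub>a f),
    assoc := (\<lambda>A B C. inv (assoc \<C> C B A)),
    lunit := runit \<C>,
    runit := lunit \<C>\<rparr>" for \<C> (structure)

text \<open>With \<open>ev : L \<otimes> R \<rightarrow> I\<close> and \<open>coev : I \<rightarrow> R \<otimes> L\<close>, the object \<open>L\<close> is a left dual of \<open>R\<close>
  and \<open>R\<close> is a right dual of \<open>L\<close>.\<close>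

definition dual_pair :: "('o, 'm, 'z) monoidal_data_scheme \<Rightarrow> 'o \<Rightarrow> 'o \<Rightarrow> bool" where
  "dual_pair \<C> L R \<longleftrightarrow> L \<in> Ob \<C> \<and> R \<in> Ob \<C> \<and>
    (\<exists>ev \<in> hom \<C> (L \<otimes> R) \<I>. \<exists>coev \<in> hom \<C> \<I> (R \<otimes> L).
      lunit \<C> L \<cdot> (ev \<otimes>\<^sub>a \<one> L) \<cdot> inv (assoc \<C> L R L) \<cdot> (\<one> L \<otimes>\<^sub>a coev) \<cdot> inv (runit \<C> L) = \<one> L \<and>
      runit \<C> R \<cdot> (\<one> R \<otimes>\<^sub>a ev) \<cdot> assoc \<C> R L R \<cdot> (coev \<otimes>\<^sub>a \<one> R) \<cdot> inv (lunit \<C> R) = \<one> R)"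
  for \<C> (structure)

definition autonomous :: "('o, 'm, 'z) monoidal_data_scheme \<Rightarrow> bool" where
  "autonomous \<C> \<longleftrightarrow> (\<forall>A \<in> Ob \<C>. (\<exists>L. dual_pair \<C> L A) \<and> (\<exists>R. dual_pair \<C> A R))"


section \<open>Traces\<close>

text \<open>\<open>Tr X A B\<close> is the component of the trace on arrows \<open>A \<otimes> X \<rightarrow> B \<otimes> X\<close>.\<close>

locale right_trace =
  fixes \<C> :: "('o, 'm, 'z) monoidal_data_scheme" (structure)
    and Tr :: "'o \<Rightarrow> 'o \<Rightarrow> 'o \<Rightarrow> 'm \<Rightarrow> 'm"
  assumes trace_in_hom: "A \<in> Ob \<C> \<Longrightarrow> B \<in> Ob \<C> \<Longrightarrow> X \<in> Ob \<C> \<Longrightarrow>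
      f \<in> hom \<C> (A \<otimes> X) (B \<otimes> X) \<Longrightarrow> Tr X A B f \<in> hom \<C> A B"
    and tightening: "X \<in> Ob \<C> \<Longrightarrow> g \<in> hom \<C> A' A \<Longrightarrow> f \<in> hom \<C> (A \<otimes> X) (B \<otimes> X) \<Longrightarrow>
      h \<in> hom \<C> B B' \<Longrightarrow>
      Tr X A' B' ((h \<otimes>\<^sub>a \<one> X) \<cdot> f \<cdot> (g \<otimes>\<^sub>a \<one> X)) = h \<cdot> Tr X A B f \<cdot> g"
    and sliding: "A \<in> Ob \<C> \<Longrightarrow> B \<in> Ob \<C> \<Longrightarrow> f \<in> hom \<C> (A \<otimes> X) (B \<otimes> Y) \<Longrightarrow>
      h \<in> hom \<C> Y X \<Longrightarrow>
      Tr X A B ((\<one> B \<otimes>\<^sub>a h) \<cdot> f) = Tr Y A B (f \<cdot> (\<one> A \<otimes>\<^sub>a h))"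
    and vanishing_unit: "A \<in> Ob \<C> \<Longrightarrow> B \<in> Ob \<C> \<Longrightarrow> f \<in> hom \<C> (A \<otimes> \<I>) (B \<otimes> \<I>) \<Longrightarrow>
      Tr \<I> A B f = runit \<C> B \<cdot> f \<cdot> inv (runit \<C> A)"
    and vanishing_tensor: "A \<in> Ob \<C> \<Longrightarrow> B \<in> Ob \<C> \<Longrightarrow> X \<in> Ob \<C> \<Longrightarrow> Y \<in> Ob \<C> \<Longrightarrow>
      f \<in> hom \<C> (A \<otimes> (X \<otimes> Y)) (B \<otimes> (X \<otimes> Y)) \<Longrightarrow>
      Tr (X \<otimes> Y) A B f
        = Tr X A B (Tr Y (A \<otimes> X) (B \<otimes> X) (inv (assoc \<C> B X Y) \<cdot> f \<cdot> assoc \<C> A X Y))"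
    and superposing: "A \<in> Ob \<C> \<Longrightarrow> B \<in> Ob \<C> \<Longrightarrow> X \<in> Ob \<C> \<Longrightarrow>
      g \<in> hom \<C> C D \<Longrightarrow> f \<in> hom \<C> (A \<otimes> X) (B \<otimes> X) \<Longrightarrow>
      Tr X (C \<otimes> A) (D \<otimes> B) (inv (assoc \<C> D B X) \<cdot> (g \<otimes>\<^sub>a f) \<cdot> assoc \<C> C A X)
        = g \<otimes>\<^sub>a Tr X A B f"

definition left_trace ::
    "('o, 'm, 'z) monoidal_data_scheme \<Rightarrow> ('o \<Rightarrow> 'o \<Rightarrow> 'o \<Rightarrow> 'm \<Rightarrow> 'm) \<Rightarrow> bool" where
  "left_trace \<C> Tr \<longleftrightarrow> right_trace (reversed \<C>) Tr"


section \<open>Non-symmetric *-autonomous categories\<close>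

text \<open>\<open>rdual A\<close> is \<open>A\<^sup>\<bottom>\<close> and \<open>ldual A\<close> is \<open>\<^sup>\<bottom>A\<close>; \<open>rtransp A X\<close> and \<open>ltransp A X\<close> are the bijections
  from \<open>hom X A\<^sup>\<bottom>\<close> to \<open>hom (A \<otimes> X) \<bottom>\<close> and from \<open>hom X \<^sup>\<bottom>A\<close> to \<open>hom (X \<otimes> A) \<bottom>\<close>.\<close>

record ('o, 'm) star_data = "('o, 'm) monoidal_data" +
  bot_ob :: 'o (\<open>\<bottom>\<index>\<close>)
  rdual :: "'o \<Rightarrow> 'o"
  ldual :: "'o \<Rightarrow> 'o"
  rtransp :: "'o \<Rightarrow> 'o \<Rightarrow> 'm \<Rightarrow> 'm"
  ltransp :: "'o \<Rightarrow> 'o \<Rightarrow> 'm \<Rightarrow> 'm"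

definition runtransp :: "('o, 'm, 'z) star_data_scheme \<Rightarrow> 'o \<Rightarrow> 'o \<Rightarrow> 'm \<Rightarrow> 'm" where
  "runtransp \<C> A X = the_inv_into (hom \<C> X (rdual \<C> A)) (rtransp \<C> A X)"

definition luntransp :: "('o, 'm, 'z) star_data_scheme \<Rightarrow> 'o \<Rightarrow> 'o \<Rightarrow> 'm \<Rightarrow> 'm" where
  "luntransp \<C> A X = the_inv_into (hom \<C> X (ldual \<C> A)) (ltransp \<C> A X)"

text \<open>\<open>ev_r A : A \<otimes> A\<^sup>\<bottom> \<rightarrow> \<bottom>\<close>, \<open>ev_l A : \<^sup>\<bottom>A \<otimes> A \<rightarrow> \<bottom>\<close>,
  \<open>bidual_lr A : A \<rightarrow> \<^sup>\<bottom>(A\<^sup>\<bottom>)\<close>, \<open>bidual_rl A : A \<rightarrow> (\<^sup>\<bottom>A)\<^sup>\<bottom>\<close>.\<close>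

definition ev_r :: "('o, 'm, 'z) star_data_scheme \<Rightarrow> 'o \<Rightarrow> 'm" where
  "ev_r \<C> A = rtransp \<C> A (rdual \<C> A) (\<one> (rdual \<C> A))" for \<C> (structure)

definition ev_l :: "('o, 'm, 'z) star_data_scheme \<Rightarrow> 'o \<Rightarrow> 'm" where
  "ev_l \<C> A = ltransp \<C> A (ldual \<C> A) (\<one> (ldual \<C> A))" for \<C> (structure)

definition bidual_lr :: "('o, 'm, 'z) star_data_scheme \<Rightarrow> 'o \<Rightarrow> 'm" where
  "bidual_lr \<C> A = luntransp \<C> (rdual \<C> A) A (ev_r \<C> A)"

definition bidual_rl :: "('o, 'm, 'z) star_data_scheme \<Rightarrow> 'o \<Rightarrow> 'm" where
  "bidual_rl \<C> A = runtransp \<C> (ldual \<C> A) A (ev_l \<C> A)"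

locale star_autonomous_category = monoidal_category \<C>
  for \<C> :: "('o, 'm, 'z) star_data_scheme" (structure) +
  assumes bot_in_Ob: "\<bottom> \<in> Ob \<C>"
    and rdual_in_Ob: "A \<in> Ob \<C> \<Longrightarrow> rdual \<C> A \<in> Ob \<C>"
    and ldual_in_Ob: "A \<in> Ob \<C> \<Longrightarrow> ldual \<C> A \<in> Ob \<C>"
    and rtransp_bij: "A \<in> Ob \<C> \<Longrightarrow> X \<in> Ob \<C> \<Longrightarrow>
      bij_betw (rtransp \<C> A X) (hom \<C> X (rdual \<C> A)) (hom \<C> (A \<otimes> X) \<bottom>)"
    and rtransp_natural: "A \<in> Ob \<C> \<Longrightarrow> f \<in> hom \<C> X (rdual \<C> A) \<Longrightarrow> u \<in> hom \<C> X' X \<Longrightarrow>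
      rtransp \<C> A X' (f \<cdot> u) = rtransp \<C> A X f \<cdot> (\<one> A \<otimes>\<^sub>a u)"
    and ltransp_bij: "A \<in> Ob \<C> \<Longrightarrow> X \<in> Ob \<C> \<Longrightarrow>
      bij_betw (ltransp \<C> A X) (hom \<C> X (ldual \<C> A)) (hom \<C> (X \<otimes> A) \<bottom>)"
    and ltransp_natural: "A \<in> Ob \<C> \<Longrightarrow> f \<in> hom \<C> X (ldual \<C> A) \<Longrightarrow> u \<in> hom \<C> X' X \<Longrightarrow>
      ltransp \<C> A X' (f \<cdot> u) = ltransp \<C> A X f \<cdot> (u \<otimes>\<^sub>a \<one> A)"
    and bidual_lr_iso: "A \<in> Ob \<C> \<Longrightarrow> iso_arrow \<C> (bidual_lr \<C> A)"
    and bidual_rl_iso: "A \<in> Ob \<C> \<Longrightarrow> iso_arrow \<C> (bidual_rl \<C> A)"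

definition rdual_arr :: "('o, 'm, 'z) star_data_scheme \<Rightarrow> 'm \<Rightarrow> 'm" where
  "rdual_arr \<C> f = runtransp \<C> (Dom \<C> f) (rdual \<C> (Cod \<C> f))
    (ev_r \<C> (Cod \<C> f) \<cdot> (f \<otimes>\<^sub>a \<one> (rdual \<C> (Cod \<C> f))))" for \<C> (structure)

definition ldual_arr :: "('o, 'm, 'z) star_data_scheme \<Rightarrow> 'm \<Rightarrow> 'm" where
  "ldual_arr \<C> f = luntransp \<C> (Dom \<C> f) (ldual \<C> (Cod \<C> f))
    (ev_l \<C> (Cod \<C> f) \<cdot> (\<one> (ldual \<C> (Cod \<C> f)) \<otimes>\<^sub>a f))" for \<C> (structure)


subsection \<open>The product par\<close>

definition par_ob :: "('o, 'm, 'z) star_data_scheme \<Rightarrow> 'o \<Rightarrow> 'o \<Rightarrow> 'o"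
    (infixr \<open>\<bindnasrepma>\<index>\<close> 70) where
  "A \<bindnasrepma>\<^bsub>\<C>\<^esub> B = ldual \<C> (rdual \<C> B \<otimes> rdual \<C> A)" for \<C> (structure)

definition par_arr :: "('o, 'm, 'z) star_data_scheme \<Rightarrow> 'm \<Rightarrow> 'm \<Rightarrow> 'm"
    (infixr \<open>\<bindnasrepma>\<^sub>a\<index>\<close> 70) where
  "f \<bindnasrepma>\<^sub>a\<^bsub>\<C>\<^esub> g = ldual_arr \<C> (rdual_arr \<C> g \<otimes>\<^sub>a rdual_arr \<C> f)" for \<C> (structure)

text \<open>The isomorphism \<open>rdual_par A B : B\<^sup>\<bottom> \<otimes> A\<^sup>\<bottom> \<rightarrow> (A \<bindnasrepma> B)\<^sup>\<bottom>\<close>.\<close>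

definition rdual_par :: "('o, 'm, 'z) star_data_scheme \<Rightarrow> 'o \<Rightarrow> 'o \<Rightarrow> 'm" where
  "rdual_par \<C> A B = bidual_rl \<C> (rdual \<C> B \<otimes> rdual \<C> A)" for \<C> (structure)

text \<open>The associator \<open>(A \<bindnasrepma> B) \<bindnasrepma> C \<rightarrow> A \<bindnasrepma> (B \<bindnasrepma> C)\<close> is the left dual of
  \<open>(B \<bindnasrepma> C)\<^sup>\<bottom> \<otimes> A\<^sup>\<bottom> \<cong> (C\<^sup>\<bottom> \<otimes> B\<^sup>\<bottom>) \<otimes> A\<^sup>\<bottom> \<cong> C\<^sup>\<bottom> \<otimes> (B\<^sup>\<bottom> \<otimes> A\<^sup>\<bottom>) \<cong> C\<^sup>\<bottom> \<otimes> (A \<bindnasrepma> B)\<^sup>\<bottom>\<close>.\<close>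

definition par_assoc :: "('o, 'm, 'z) star_data_scheme \<Rightarrow> 'o \<Rightarrow> 'o \<Rightarrow> 'o \<Rightarrow> 'm" where
  "par_assoc \<C> A B C = ldual_arr \<C>
    ((\<one> (rdual \<C> C) \<otimes>\<^sub>a rdual_par \<C> A B)
      \<cdot> assoc \<C> (rdual \<C> C) (rdual \<C> B) (rdual \<C> A)
      \<cdot> (inv (rdual_par \<C> B C) \<otimes>\<^sub>a \<one> (rdual \<C> A)))" for \<C> (structure)

text \<open>The unitors \<open>\<bottom> \<bindnasrepma> A \<rightarrow> A\<close> and \<open>A \<bindnasrepma> \<bottom> \<rightarrow> A\<close> use the map \<open>I \<rightarrow> \<bottom>\<^sup>\<bottom>\<close>
  corresponding to \<open>\<bottom> \<otimes> I \<cong> \<bottom>\<close>.\<close>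

definition unit_rdual_bot :: "('o, 'm, 'z) star_data_scheme \<Rightarrow> 'm" where
  "unit_rdual_bot \<C> = runtransp \<C> \<bottom> \<I> (runit \<C> \<bottom>)" for \<C> (structure)

definition par_lunit :: "('o, 'm, 'z) star_data_scheme \<Rightarrow> 'o \<Rightarrow> 'm" where
  "par_lunit \<C> A = inv (bidual_lr \<C> A)
    \<cdot> ldual_arr \<C> ((\<one> (rdual \<C> A) \<otimes>\<^sub>a unit_rdual_bot \<C>) \<cdot> inv (runit \<C> (rdual \<C> A)))"
  for \<C> (structure)

definition par_runit :: "('o, 'm, 'z) star_data_scheme \<Rightarrow> 'o \<Rightarrow> 'm" where
  "par_runit \<C> A = inv (bidual_lr \<C> A)
    \<cdot> ldual_arr \<C> ((unit_rdual_bot \<C> \<otimes>\<^sub>a \<one> (rdual \<C> A)) \<cdot> inv (lunit \<C> (rdual \<C> A)))"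
  for \<C> (structure)

text \<open>The counit \<open>counit_r A B : (A \<bindnasrepma> B) \<otimes> B\<^sup>\<bottom> \<rightarrow> A \<cong> \<^sup>\<bottom>(A\<^sup>\<bottom>)\<close> corresponds to the evaluation
  \<open>(A \<bindnasrepma> B) \<otimes> (B\<^sup>\<bottom> \<otimes> A\<^sup>\<bottom>) \<rightarrow> \<bottom>\<close>.  The counit \<open>counit_l A B : \<^sup>\<bottom>A \<otimes> (A \<bindnasrepma> B) \<rightarrow> B \<cong> \<^sup>\<bottom>(B\<^sup>\<bottom>)\<close>
  corresponds to \<open>\<^sup>\<bottom>A \<otimes> (A \<bindnasrepma> B) \<otimes> B\<^sup>\<bottom> \<rightarrow> \<^sup>\<bottom>A \<otimes> A \<rightarrow> \<bottom>\<close>; equivalently, it is the mirror image of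
  \<open>counit_r\<close> read through the isomorphism \<open>A \<bindnasrepma> B \<cong> (\<^sup>\<bottom>B \<otimes> \<^sup>\<bottom>A)\<^sup>\<bottom>\<close>.\<close>

definition counit_r :: "('o, 'm, 'z) star_data_scheme \<Rightarrow> 'o \<Rightarrow> 'o \<Rightarrow> 'm" where
  "counit_r \<C> A B = inv (bidual_lr \<C> A)
    \<cdot> luntransp \<C> (rdual \<C> A) ((A \<bindnasrepma> B) \<otimes> rdual \<C> B)
        (ev_l \<C> (rdual \<C> B \<otimes> rdual \<C> A) \<cdot> assoc \<C> (A \<bindnasrepma> B) (rdual \<C> B) (rdual \<C> A))"
  for \<C> (structure)

definition counit_l :: "('o, 'm, 'z) star_data_scheme \<Rightarrow> 'o \<Rightarrow> 'o \<Rightarrow> 'm" where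
  "counit_l \<C> A B = inv (bidual_lr \<C> B)
    \<cdot> luntransp \<C> (rdual \<C> B) (ldual \<C> A \<otimes> (A \<bindnasrepma> B))
        (ev_l \<C> A \<cdot> (\<one> (ldual \<C> A) \<otimes>\<^sub>a counit_r \<C> A B)
          \<cdot> assoc \<C> (ldual \<C> A) (A \<bindnasrepma> B) (rdual \<C> B))"
  for \<C> (structure)

text \<open>The isomorphism \<open>ldual_par A B : \<^sup>\<bottom>B \<otimes> \<^sup>\<bottom>A \<rightarrow> \<^sup>\<bottom>(A \<bindnasrepma> B)\<close>.\<close>

definition ldual_par :: "('o, 'm, 'z) star_data_scheme \<Rightarrow> 'o \<Rightarrow> 'o \<Rightarrow> 'm" where
  "ldual_par \<C> A B = luntransp \<C> (A \<bindnasrepma> B) (ldual \<C> B \<otimes> ldual \<C> A)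
    (ev_l \<C> B \<cdot> (\<one> (ldual \<C> B) \<otimes>\<^sub>a counit_l \<C> A B)
      \<cdot> assoc \<C> (ldual \<C> B) (ldual \<C> A) (A \<bindnasrepma> B))" for \<C> (structure)

text \<open>The bijections \<open>hom (A \<otimes> Y) M \<cong> hom A (M \<bindnasrepma> \<^sup>\<bottom>Y)\<close> and \<open>hom (Y \<otimes> A) M \<cong> hom A (Y\<^sup>\<bottom> \<bindnasrepma> M)\<close>,
  from left to right.  Their inverses are given by the counits.\<close>

definition transpose_r :: "('o, 'm, 'z) star_data_scheme \<Rightarrow> 'o \<Rightarrow> 'o \<Rightarrow> 'o \<Rightarrow> 'm \<Rightarrow> 'm" where
  "transpose_r \<C> A Y M = the_inv_into (hom \<C> A (M \<bindnasrepma> ldual \<C> Y))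
    (\<lambda>k. counit_r \<C> M (ldual \<C> Y) \<cdot> (k \<otimes>\<^sub>a bidual_rl \<C> Y))" for \<C> (structure)

definition transpose_l :: "('o, 'm, 'z) star_data_scheme \<Rightarrow> 'o \<Rightarrow> 'o \<Rightarrow> 'o \<Rightarrow> 'm \<Rightarrow> 'm" where
  "transpose_l \<C> A Y M = the_inv_into (hom \<C> A (rdual \<C> Y \<bindnasrepma> M))
    (\<lambda>k. counit_l \<C> (rdual \<C> Y) M \<cdot> (bidual_lr \<C> Y \<otimes>\<^sub>a k))" for \<C> (structure)

text \<open>\<open>coev_r D : I \<rightarrow> D \<bindnasrepma> \<^sup>\<bottom>D\<close> and \<open>coev_l D : I \<rightarrow> D\<^sup>\<bottom> \<bindnasrepma> D\<close>.\<close>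

definition coev_r :: "('o, 'm, 'z) star_data_scheme \<Rightarrow> 'o \<Rightarrow> 'm" where
  "coev_r \<C> D = transpose_r \<C> \<I> D D (lunit \<C> D)" for \<C> (structure)

definition coev_l :: "('o, 'm, 'z) star_data_scheme \<Rightarrow> 'o \<Rightarrow> 'm" where
  "coev_l \<C> D = transpose_l \<C> \<I> D D (runit \<C> D)" for \<C> (structure)

text \<open>The linear distributors \<open>delta_L A B C : A \<otimes> (B \<bindnasrepma> C) \<rightarrow> (A \<otimes> B) \<bindnasrepma> C\<close> and
  \<open>delta_R A B C : (A \<bindnasrepma> B) \<otimes> C \<rightarrow> A \<bindnasrepma> (B \<otimes> C)\<close>; the transposes take values in
  \<open>(A \<otimes> B) \<bindnasrepma> \<^sup>\<bottom>(C\<^sup>\<bottom>)\<close> and \<open>(\<^sup>\<bottom>A)\<^sup>\<bottom> \<bindnasrepma> (B \<otimes> C)\<close>.\<close>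

definition delta_L :: "('o, 'm, 'z) star_data_scheme \<Rightarrow> 'o \<Rightarrow> 'o \<Rightarrow> 'o \<Rightarrow> 'm" where
  "delta_L \<C> A B C = (\<one> (A \<otimes> B) \<bindnasrepma>\<^sub>a inv (bidual_lr \<C> C))
    \<cdot> transpose_r \<C> (A \<otimes> (B \<bindnasrepma> C)) (rdual \<C> C) (A \<otimes> B)
        ((\<one> A \<otimes>\<^sub>a counit_r \<C> B C) \<cdot> assoc \<C> A (B \<bindnasrepma> C) (rdual \<C> C))" for \<C> (structure)

definition delta_R :: "('o, 'm, 'z) star_data_scheme \<Rightarrow> 'o \<Rightarrow> 'o \<Rightarrow> 'o \<Rightarrow> 'm" where
  "delta_R \<C> A B C = (inv (bidual_rl \<C> A) \<bindnasrepma>\<^sub>a \<one> (B \<otimes> C))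
    \<cdot> transpose_l \<C> ((A \<bindnasrepma> B) \<otimes> C) (ldual \<C> A) (B \<otimes> C)
        ((counit_l \<C> A B \<otimes>\<^sub>a \<one> C) \<cdot> inv (assoc \<C> (ldual \<C> A) (A \<bindnasrepma> B) C))" for \<C> (structure)


subsection \<open>The induced traces for par\<close>

text \<open>The isomorphisms \<open>(E \<bindnasrepma> Z)\<^sup>\<bottom> \<cong> Z\<^sup>\<bottom> \<otimes> E\<^sup>\<bottom>\<close> and \<open>\<^sup>\<bottom>(Z \<bindnasrepma> E) \<cong> \<^sup>\<bottom>E \<otimes> \<^sup>\<bottom>Z\<close> are inserted.  The right
  trace is induced by a left tensor trace \<open>TrL\<close>, the left one by a right tensor trace \<open>TrR\<close>.\<close>

definition par_trace_r :: "('o, 'm, 'z) star_data_scheme \<Rightarrow> ('o \<Rightarrow> 'o \<Rightarrow> 'o \<Rightarrow> 'm \<Rightarrow> 'm) \<Rightarrow>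
    'o \<Rightarrow> 'o \<Rightarrow> 'o \<Rightarrow> 'm \<Rightarrow> 'm" where
  "par_trace_r \<C> TrL Z E R f = (THE g. g \<in> hom \<C> E R \<and>
    rdual_arr \<C> g = TrL (rdual \<C> Z) (rdual \<C> R) (rdual \<C> E)
      (inv (rdual_par \<C> E Z) \<cdot> rdual_arr \<C> f \<cdot> rdual_par \<C> R Z))" for \<C> (structure)

definition par_trace_l :: "('o, 'm, 'z) star_data_scheme \<Rightarrow> ('o \<Rightarrow> 'o \<Rightarrow> 'o \<Rightarrow> 'm \<Rightarrow> 'm) \<Rightarrow>
    'o \<Rightarrow> 'o \<Rightarrow> 'o \<Rightarrow> 'm \<Rightarrow> 'm" where
  "par_trace_l \<C> TrR Z E R f = (THE g. g \<in> hom \<C> E R \<and>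
    ldual_arr \<C> g = TrR (ldual \<C> Z) (ldual \<C> R) (ldual \<C> E)
      (inv (ldual_par \<C> Z E) \<cdot> ldual_arr \<C> f \<cdot> ldual_par \<C> Z R))" for \<C> (structure)


subsection \<open>The operations Theta and Theta'\<close>

definition theta_inner :: "('o, 'm, 'z) star_data_scheme \<Rightarrow> ('o \<Rightarrow> 'o \<Rightarrow> 'o \<Rightarrow> 'm \<Rightarrow> 'm) \<Rightarrow>
    'o \<Rightarrow> 'o \<Rightarrow> 'o \<Rightarrow> 'm \<Rightarrow> 'm" where
  "theta_inner \<C> TrR B D X g = TrR D (B \<bindnasrepma> ldual \<C> D) X
    (par_runit \<C> (X \<otimes> D)
      \<cdot> (\<one> (X \<otimes> D) \<bindnasrepma>\<^sub>a ev_l \<C> D)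
      \<cdot> delta_R \<C> (X \<otimes> D) (ldual \<C> D) D
      \<cdot> ((g \<bindnasrepma>\<^sub>a \<one> (ldual \<C> D)) \<otimes>\<^sub>a \<one> D))" for \<C> (structure)

text \<open>\<open>Theta \<C> TrR TrL A B C D X f g : A \<bindnasrepma> B \<rightarrow> C \<otimes> D\<close> for \<open>f : A \<bindnasrepma> X \<rightarrow> C\<close> and
  \<open>g : B \<rightarrow> X \<otimes> D\<close>.\<close>

definition Theta :: "('o, 'm, 'z) star_data_scheme \<Rightarrow>
    ('o \<Rightarrow> 'o \<Rightarrow> 'o \<Rightarrow> 'm \<Rightarrow> 'm) \<Rightarrow> ('o \<Rightarrow> 'o \<Rightarrow> 'o \<Rightarrow> 'm \<Rightarrow> 'm) \<Rightarrow>
    'o \<Rightarrow> 'o \<Rightarrow> 'o \<Rightarrow> 'o \<Rightarrow> 'o \<Rightarrow> 'm \<Rightarrow> 'm \<Rightarrow> 'm" where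
  "Theta \<C> TrR TrL A B C D X f g = par_trace_r \<C> TrL (ldual \<C> D) (A \<bindnasrepma> B) (C \<otimes> D)
    (delta_L \<C> C D (ldual \<C> D)
      \<cdot> (\<one> C \<otimes>\<^sub>a coev_r \<C> D)
      \<cdot> inv (runit \<C> C)
      \<cdot> f
      \<cdot> (\<one> A \<bindnasrepma>\<^sub>a theta_inner \<C> TrR B D X g)
      \<cdot> par_assoc \<C> A B (ldual \<C> D))" for \<C> (structure)

definition theta_inner' :: "('o, 'm, 'z) star_data_scheme \<Rightarrow> ('o \<Rightarrow> 'o \<Rightarrow> 'o \<Rightarrow> 'm \<Rightarrow> 'm) \<Rightarrow>
    'o \<Rightarrow> 'o \<Rightarrow> 'o \<Rightarrow> 'm \<Rightarrow> 'm" where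
  "theta_inner' \<C> TrL B D X g = TrL D (rdual \<C> D \<bindnasrepma> B) X
    (par_lunit \<C> (D \<otimes> X)
      \<cdot> (ev_r \<C> D \<bindnasrepma>\<^sub>a \<one> (D \<otimes> X))
      \<cdot> delta_L \<C> D (rdual \<C> D) (D \<otimes> X)
      \<cdot> (\<one> D \<otimes>\<^sub>a (\<one> (rdual \<C> D) \<bindnasrepma>\<^sub>a g)))" for \<C> (structure)

text \<open>\<open>Theta' \<C> TrR TrL A B C D X f g : B \<bindnasrepma> A \<rightarrow> D \<otimes> C\<close> for \<open>f : X \<bindnasrepma> A \<rightarrow> C\<close> and
  \<open>g : B \<rightarrow> D \<otimes> X\<close>.\<close>

definition Theta' :: "('o, 'm, 'z) star_data_scheme \<Rightarrow>
    ('o \<Rightarrow> 'o \<Rightarrow> 'o \<Rightarrow> 'm \<Rightarrow> 'm) \<Rightarrow> ('o \<Rightarrow> 'o \<Rightarrow> 'o \<Rightarrow> 'm \<Rightarrow> 'm) \<Rightarrow>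
    'o \<Rightarrow> 'o \<Rightarrow> 'o \<Rightarrow> 'o \<Rightarrow> 'o \<Rightarrow> 'm \<Rightarrow> 'm \<Rightarrow> 'm" where
  "Theta' \<C> TrR TrL A B C D X f g = par_trace_l \<C> TrR (rdual \<C> D) (B \<bindnasrepma> A) (D \<otimes> C)
    (delta_R \<C> (rdual \<C> D) D C
      \<cdot> (coev_l \<C> D \<otimes>\<^sub>a \<one> C)
      \<cdot> inv (lunit \<C> C)
      \<cdot> f
      \<cdot> (theta_inner' \<C> TrL B D X g \<bindnasrepma>\<^sub>a \<one> A)
      \<cdot> inv (par_assoc \<C> (rdual \<C> D) B A))" for \<C> (structure)

end

theory Submission
  imports Defs
begin

text \<open>With identities for all free arrows, the equation for the tensor counit says that \<open>Theta(1, 1)\<close>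
  is a section of the distributor \<open>\<delta>\<^sub>R : (A \<bindnasrepma> P) \<otimes> Q \<rightarrow> A \<bindnasrepma> (P \<otimes> Q)\<close>, and the equation for the par
  counit says that the very same arrow is a retraction of it.  So every \<open>\<delta>\<^sub>R\<close> is invertible, and the
  mirror-image equations make every \<open>\<delta>\<^sub>L : Q \<otimes> (P \<bindnasrepma> A) \<rightarrow> (Q \<otimes> P) \<bindnasrepma> A\<close> invertible.

  Invertible distributors give duals.  In a *-autonomous category the functor \<open>- \<otimes> R\<close> has the right
  adjoint \<open>- \<bindnasrepma> \<^sup>\<bottom>R\<close>.  An isomorphism \<open>A \<otimes> (I \<bindnasrepma> \<^sup>\<bottom>R) \<cong> A \<bindnasrepma> \<^sup>\<bottom>R\<close> that respects the counits turns this
  right adjoint into \<open>- \<otimes> (I \<bindnasrepma> \<^sup>\<bottom>R)\<close>, with counit \<open>A \<otimes> e\<close> for a single \<open>e : (I \<bindnasrepma> \<^sup>\<bottom>R) \<otimes> R \<rightarrow> I\<close>.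
  By \<open>dual_pair_of_universal_right\<close> such an \<open>e\<close> is the evaluation of a dual pair: its
  universality at \<open>R\<close> yields the coevaluation and one zigzag equation, uniqueness at \<open>I\<close>
  yields the other.  Hence \<open>I \<bindnasrepma> \<^sup>\<bottom>R\<close> is a left dual of \<open>R\<close>, and symmetrically \<open>L\<^sup>\<bottom> \<bindnasrepma> I\<close> is a right
  dual of \<open>L\<close>.

  The rest of the work makes the operations typed and the transposes universal.  Both counits of par
  are universal because the evaluations are perfect pairings, and the induced par traces take values
  in the expected hom sets because duality is fully faithful and
  exchanges par with the reversed tensor product.\<close>


section \<open>Bijections\<close>

text \<open>The counits and the duality functors get their bijectivity from this cancellation: an evaluation
  \<open>p\<close> known to be universal factors through another one, \<open>q\<close>, along the map in question.\<close>

lemma bij_betw_factor: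
  assumes "bij_betw p S U" "bij_betw q T U" "\<And>s. s \<in> S \<Longrightarrow> h s \<in> T" "\<And>s. s \<in> S \<Longrightarrow> q (h s) = p s"
  shows "bij_betw h S T"
proof -
  have "bij_betw (\<lambda>s. q (h s)) S U"
    using assms(1,4) by (simp cong: bij_betw_cong)
  moreover have "h s = the_inv_into T q (q (h s))" if "s \<in> S" for s
    using that assms(2,3) by (simp add: bij_betw_def the_inv_into_f_f)
  ultimately show ?thesis
    using bij_betw_trans [of "\<lambda>s. q (h s)" S U "the_inv_into T q" T] bij_betw_the_inv_into [OF assms(2)]
    by (simp add: o_def cong: bij_betw_cong)
qed

lemma the_inv_into_props:
  assumes "bij_betw p S U" "u \<in> U"
  shows "the_inv_into S p u \<in> S" "p (the_inv_into S p u) = u"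
  using assms by (auto simp: bij_betw_def intro: the_inv_into_into f_the_inv_into_f)

lemma the_preimage_mem:
  assumes "bij_betw p S U" "u \<in> U"
  shows "(THE s. s \<in> S \<and> p s = u) \<in> S"
proof -
  have "\<exists>!s. s \<in> S \<and> p s = u"
    using assms by (auto simp: bij_betw_def inj_on_def)
  from theI' [OF this] show ?thesis
    by blast
qed


section \<open>Categories\<close>

context category
begin

text \<open>Membership in hom sets is unfolded into domain and codomain equations, which the simplifier
  decides by computation; the introduction rule for composites would have to guess the object in
  the middle.\<close>

lemma in_hom_iff: "f \<in> hom \<C> A B \<longleftrightarrow> f \<in> Arr \<C> \<and> Dom \<C> f = A \<and> Cod \<C> f = B"
  by (simp add: hom_def)

lemma in_homE:
  assumes "f \<in> hom \<C> A B"
  shows "f \<in> Arr \<C>" "Dom \<C> f = A" "Cod \<C> f = B" "A \<in> Ob \<C>" "B \<in> Ob \<C>"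
  using assms Dom_in_Ob Cod_in_Ob by (auto simp: in_hom_iff)

lemma iso_arrow_Arr [simp]: "iso_arrow \<C> f \<Longrightarrow> f \<in> Arr \<C>"
  by (simp add: iso_arrow_def)

lemma ident_simps [simp]:
  assumes "A \<in> Ob \<C>"
  shows "\<one> A \<in> Arr \<C>" "Dom \<C> (\<one> A) = A" "Cod \<C> (\<one> A) = A"
  using ident_in_hom [OF assms] by (auto simp: in_hom_iff)

lemma comp_simps [simp]:
  assumes "f \<in> Arr \<C>" "g \<in> Arr \<C>" "Cod \<C> f = Dom \<C> g"
  shows "g \<cdot> f \<in> Arr \<C>" "Dom \<C> (g \<cdot> f) = Dom \<C> f" "Cod \<C> (g \<cdot> f) = Cod \<C> g"
  using comp_in_hom [of f "Dom \<C> f" "Cod \<C> f" g "Cod \<C> g"] assms by (auto simp: in_hom_iff)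

lemma comp_ident_simps [simp]:
  assumes "f \<in> Arr \<C>"
  shows "Cod \<C> f = B \<Longrightarrow> \<one> B \<cdot> f = f" "Dom \<C> f = A \<Longrightarrow> f \<cdot> \<one> A = f"
  using comp_ident_left comp_ident_right assms by (auto simp: in_hom_iff)

lemma comp_assoc_simp [simp]:
  assumes "f \<in> Arr \<C>" "g \<in> Arr \<C>" "h \<in> Arr \<C>" "Cod \<C> f = Dom \<C> g" "Cod \<C> g = Dom \<C> h"
  shows "(h \<cdot> g) \<cdot> f = h \<cdot> (g \<cdot> f)"
  using comp_assoc [of f "Dom \<C> f" "Cod \<C> f" g "Cod \<C> g" h "Cod \<C> h"] assms
  by (auto simp: in_hom_iff)

declare Dom_in_Ob [simp] Cod_in_Ob [simp]

text \<open>The simplifier keeps composites associated to the right, so an equation for \<open>g \<cdot> f\<close> only becomes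
  visible inside a longer composite after this reassociation.  Lemmas ending in \<open>_tail\<close> are
  instances of it.\<close>

lemma comp_tail:
  assumes "g \<cdot> f = k" "f \<in> Arr \<C>" "g \<in> Arr \<C>" "w \<in> Arr \<C>"
    "Cod \<C> w = Dom \<C> f" "Cod \<C> f = Dom \<C> g"
  shows "g \<cdot> (f \<cdot> w) = k \<cdot> w"
  using comp_assoc_simp [of w f g] assms by simp

lemma inverse_arrow_eq:
  assumes "f \<in> hom \<C> A B" "g \<in> hom \<C> B A" "g \<cdot> f = \<one> A" "f \<cdot> g = \<one> B"
  shows "iso_arrow \<C> f" "inv f = g"
proof -
  have i: "inverse_arrows \<C> f g"
    using assms by (auto simp: inverse_arrows_def in_hom_iff)
  have "h = g" if "inverse_arrows \<C> f h" for h
  proof -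
    have h: "h \<in> hom \<C> B A" "h \<cdot> f = \<one> A"
      using that assms by (auto simp: inverse_arrows_def in_hom_iff)
    have "h = h \<cdot> (f \<cdot> g)"
      using h assms by (simp add: in_hom_iff)
    also have "\<dots> = (h \<cdot> f) \<cdot> g"
      using h(1) assms(1,2) by (simp add: in_hom_iff)
    also have "\<dots> = g"
      using h(2) assms(2) by (simp add: in_hom_iff)
    finally show ?thesis .
  qed
  then show "inv f = g"
    unfolding inverse_arrow_def using i by (intro the_equality) blast+
  show "iso_arrow \<C> f"
    using i assms(1) by (auto simp: iso_arrow_def in_hom_iff)
qed

lemma inverse_simps [simp]:
  assumes "iso_arrow \<C> f"
  shows "inv f \<in> Arr \<C>" "Dom \<C> (inv f) = Cod \<C> f" "Cod \<C> (inv f) = Dom \<C> f"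
    "inv f \<cdot> f = \<one> (Dom \<C> f)" "f \<cdot> inv f = \<one> (Cod \<C> f)" "iso_arrow \<C> (inv f)" "inv (inv f) = f"
proof -
  have a: "f \<in> Arr \<C>"
    using assms by (simp add: iso_arrow_def)
  from assms obtain g where g: "inverse_arrows \<C> f g"
    by (auto simp: iso_arrow_def)
  then have h: "f \<in> hom \<C> (Dom \<C> f) (Cod \<C> f)" "g \<in> hom \<C> (Cod \<C> f) (Dom \<C> f)"
    "g \<cdot> f = \<one> (Dom \<C> f)" "f \<cdot> g = \<one> (Cod \<C> f)"
    using a by (auto simp: inverse_arrows_def in_hom_iff)
  note e = inverse_arrow_eq(2) [OF h]
  show "inv f \<in> Arr \<C>" "Dom \<C> (inv f) = Cod \<C> f" "Cod \<C> (inv f) = Dom \<C> f"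
    "inv f \<cdot> f = \<one> (Dom \<C> f)" "f \<cdot> inv f = \<one> (Cod \<C> f)"
    using h e by (auto simp: in_hom_iff)
  show "iso_arrow \<C> (inv f)" "inv (inv f) = f"
    using inverse_arrow_eq [OF h(2,1,4,3)] e by auto
qed

lemma inverse_cancel [simp]:
  assumes "iso_arrow \<C> f" "g \<in> Arr \<C>"
  shows "Cod \<C> g = Dom \<C> f \<Longrightarrow> inv f \<cdot> (f \<cdot> g) = g"
    "Cod \<C> g = Cod \<C> f \<Longrightarrow> f \<cdot> (inv f \<cdot> g) = g"
  using assms by (simp_all flip: comp_assoc_simp)

lemma iso_cancel_left:
  assumes "iso_arrow \<C> f" "g \<in> Arr \<C>" "h \<in> Arr \<C>" "Cod \<C> g = Dom \<C> f" "Cod \<C> h = Dom \<C> f"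
    "f \<cdot> g = f \<cdot> h"
  shows "g = h"
proof -
  have "g = inv f \<cdot> (f \<cdot> g)" "h = inv f \<cdot> (f \<cdot> h)"
    using assms(1-5) by simp_all
  then show ?thesis
    using assms(6) by metis
qed

lemma iso_cancel_right:
  assumes "iso_arrow \<C> f" "g \<in> Arr \<C>" "h \<in> Arr \<C>" "Dom \<C> g = Cod \<C> f" "Dom \<C> h = Cod \<C> f"
    "g \<cdot> f = h \<cdot> f"
  shows "g = h"
proof -
  have "g = (g \<cdot> f) \<cdot> inv f" "h = (h \<cdot> f) \<cdot> inv f"
    using assms(1-5) by simp_all
  then show ?thesis
    using assms(6) by metis
qed

lemma iso_comp [simp]:
  assumes "iso_arrow \<C> f" "iso_arrow \<C> g" "Cod \<C> f = Dom \<C> g"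
  shows "iso_arrow \<C> (g \<cdot> f)"
  by (rule inverse_arrow_eq(1) [of _ "Dom \<C> f" "Cod \<C> g" "inv f \<cdot> inv g"])
    (use assms in \<open>simp_all add: in_hom_iff\<close>)

lemma bij_betw_postcomp:
  assumes "iso_arrow \<C> f" "f \<in> hom \<C> A B" 
  shows "bij_betw (\<lambda>k. f \<cdot> k) (hom \<C> X A) (hom \<C> X B)"
  by (rule bij_betw_byWitness [where f' = "\<lambda>k. inv f \<cdot> k"])
    (use assms in \<open>auto simp: in_hom_iff\<close>)

lemma bij_betw_precomp:
  assumes "iso_arrow \<C> f" "f \<in> hom \<C> A B" 
  shows "bij_betw (\<lambda>k. k \<cdot> f) (hom \<C> B X) (hom \<C> A X)"
  by (rule bij_betw_byWitness [where f' = "\<lambda>k. k \<cdot> inv f"])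
    (use assms in \<open>auto simp: in_hom_iff\<close>)

text \<open>The representable form of the Yoneda lemma: a preimage of the identity is a section, and by
  injectivity it is also a retraction.\<close>

lemma iso_if_postcomp_bij:
  assumes f: "f \<in> hom \<C> A B"
    and bij: "\<And>X. X \<in> Ob \<C> \<Longrightarrow> bij_betw (\<lambda>k. f \<cdot> k) (hom \<C> X A) (hom \<C> X B)"
  shows "iso_arrow \<C> f"
proof -
  have f': "f \<in> Arr \<C>" "Dom \<C> f = A" "Cod \<C> f = B" "A \<in> Ob \<C>" "B \<in> Ob \<C>"
    using in_homE [OF f] by auto
  have "\<one> B \<in> (\<lambda>k. f \<cdot> k) ` hom \<C> B A"
    using bij [of B] f' by (simp add: bij_betw_def ident_in_hom)
  then obtain g where g: "g \<in> hom \<C> B A" "f \<cdot> g = \<one> B"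
    by auto
  have "g \<cdot> f = \<one> A"
  proof (rule inj_onD [OF bij_betw_imp_inj_on [OF bij [of A]]])
    have "f \<cdot> (g \<cdot> f) = (f \<cdot> g) \<cdot> f"
      using f' g(1) by (simp add: in_hom_iff)
    then show "f \<cdot> (g \<cdot> f) = f \<cdot> \<one> A"
      using f' g(2) by simp
  qed (use f' g in \<open>auto simp: in_hom_iff\<close>)
  then show ?thesis
    using inverse_arrow_eq(1) [OF f g(1) _ g(2)] by blast
qed

end

section \<open>Monoidal categories and their reversals\<close>

context monoidal_category
begin

declare tensor_ob_in_Ob [simp] unit_in_Ob [simp] assoc_iso [simp] lunit_iso [simp] runit_iso [simp]
  tensor_ident [simp]

lemma tensor_simps [simp]:
  assumes "f \<in> Arr \<C>" "g \<in> Arr \<C>"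
  shows "f \<otimes>\<^sub>a g \<in> Arr \<C>" "Dom \<C> (f \<otimes>\<^sub>a g) = Dom \<C> f \<otimes> Dom \<C> g"
    "Cod \<C> (f \<otimes>\<^sub>a g) = Cod \<C> f \<otimes> Cod \<C> g"
  using tensor_arr_in_hom [of f "Dom \<C> f" "Cod \<C> f" g "Dom \<C> g" "Cod \<C> g"] assms
  by (auto simp: in_hom_iff)

lemma structure_simps [simp]:
  "A \<in> Ob \<C> \<Longrightarrow> B \<in> Ob \<C> \<Longrightarrow> C \<in> Ob \<C> \<Longrightarrow> Dom \<C> (assoc \<C> A B C) = (A \<otimes> B) \<otimes> C"
  "A \<in> Ob \<C> \<Longrightarrow> B \<in> Ob \<C> \<Longrightarrow> C \<in> Ob \<C> \<Longrightarrow> Cod \<C> (assoc \<C> A B C) = A \<otimes> (B \<otimes> C)"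
  "A \<in> Ob \<C> \<Longrightarrow> Dom \<C> (lunit \<C> A) = \<I> \<otimes> A" "A \<in> Ob \<C> \<Longrightarrow> Cod \<C> (lunit \<C> A) = A"
  "A \<in> Ob \<C> \<Longrightarrow> Dom \<C> (runit \<C> A) = A \<otimes> \<I>" "A \<in> Ob \<C> \<Longrightarrow> Cod \<C> (runit \<C> A) = A"
  using assoc_in_hom lunit_in_hom runit_in_hom by (auto simp: in_hom_iff)

lemma interchange:
  assumes "f \<in> Arr \<C>" "g \<in> Arr \<C>" "f' \<in> Arr \<C>" "g' \<in> Arr \<C>" "Cod \<C> f = Dom \<C> g" "Cod \<C> f' = Dom \<C> g'"
  shows "(g \<otimes>\<^sub>a g') \<cdot> (f \<otimes>\<^sub>a f') = (g \<cdot> f) \<otimes>\<^sub>a (g' \<cdot> f')"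
  using tensor_comp [of f "Dom \<C> f" "Cod \<C> f" g "Cod \<C> g" f' "Dom \<C> f'" "Cod \<C> f'" g' "Cod \<C> g'"]
    assms by (simp add: in_hom_iff)

lemma interchange_tail:
  assumes "f \<in> Arr \<C>" "g \<in> Arr \<C>" "f' \<in> Arr \<C>" "g' \<in> Arr \<C>" "Cod \<C> f = Dom \<C> g" "Cod \<C> f' = Dom \<C> g'"
    "w \<in> Arr \<C>" "Cod \<C> w = Dom \<C> f \<otimes> Dom \<C> f'"
  shows "(g \<otimes>\<^sub>a g') \<cdot> ((f \<otimes>\<^sub>a f') \<cdot> w) = ((g \<cdot> f) \<otimes>\<^sub>a (g' \<cdot> f')) \<cdot> w"
  by (rule comp_tail [OF interchange]) (use assms in simp_all)

lemma assoc_nat: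
  assumes "f \<in> Arr \<C>" "g \<in> Arr \<C>" "h \<in> Arr \<C>"
    "Cod \<C> f = A" "Cod \<C> g = B" "Cod \<C> h = C"
  shows "assoc \<C> A B C \<cdot> ((f \<otimes>\<^sub>a g) \<otimes>\<^sub>a h)
    = (f \<otimes>\<^sub>a (g \<otimes>\<^sub>a h)) \<cdot> assoc \<C> (Dom \<C> f) (Dom \<C> g) (Dom \<C> h)"
  using assoc_natural [of f _ A g _ B h _ C] assms by (simp add: in_hom_iff)

lemma assoc_nat_tail:
  assumes "f \<in> Arr \<C>" "g \<in> Arr \<C>" "h \<in> Arr \<C>"
    "Cod \<C> f = A" "Cod \<C> g = B" "Cod \<C> h = C" "w \<in> Arr \<C>" "Cod \<C> w = (Dom \<C> f \<otimes> Dom \<C> g) \<otimes> Dom \<C> h"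
  shows "assoc \<C> A B C \<cdot> (((f \<otimes>\<^sub>a g) \<otimes>\<^sub>a h) \<cdot> w)
    = (f \<otimes>\<^sub>a (g \<otimes>\<^sub>a h)) \<cdot> (assoc \<C> (Dom \<C> f) (Dom \<C> g) (Dom \<C> h) \<cdot> w)"
  using comp_tail [OF assoc_nat, of f g h A B C w] assms by auto

lemma inv_assoc_nat:
  assumes "f \<in> Arr \<C>" "g \<in> Arr \<C>" "h \<in> Arr \<C>"
    "Cod \<C> f = A" "Cod \<C> g = B" "Cod \<C> h = C"
  shows "inv (assoc \<C> A B C) \<cdot> (f \<otimes>\<^sub>a (g \<otimes>\<^sub>a h))
    = ((f \<otimes>\<^sub>a g) \<otimes>\<^sub>a h) \<cdot> inv (assoc \<C> (Dom \<C> f) (Dom \<C> g) (Dom \<C> h))"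
proof (rule iso_cancel_right [where f = "assoc \<C> (Dom \<C> f) (Dom \<C> g) (Dom \<C> h)"])
  show "(inv (assoc \<C> A B C) \<cdot> (f \<otimes>\<^sub>a (g \<otimes>\<^sub>a h))) \<cdot> assoc \<C> (Dom \<C> f) (Dom \<C> g) (Dom \<C> h)
    = (((f \<otimes>\<^sub>a g) \<otimes>\<^sub>a h) \<cdot> inv (assoc \<C> (Dom \<C> f) (Dom \<C> g) (Dom \<C> h)))
      \<cdot> assoc \<C> (Dom \<C> f) (Dom \<C> g) (Dom \<C> h)"
    using assms by (auto simp flip: assoc_nat)
qed (use assms in auto)

lemma lunit_nat:
  assumes "f \<in> Arr \<C>" "Cod \<C> f = B"
  shows "lunit \<C> B \<cdot> (\<one> \<I> \<otimes>\<^sub>a f) = f \<cdot> lunit \<C> (Dom \<C> f)"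
  using lunit_natural [of f _ B] assms by (simp add: in_hom_iff)

lemma runit_nat:
  assumes "f \<in> Arr \<C>" "Cod \<C> f = B"
  shows "runit \<C> B \<cdot> (f \<otimes>\<^sub>a \<one> \<I>) = f \<cdot> runit \<C> (Dom \<C> f)"
  using runit_natural [of f _ B] assms by (simp add: in_hom_iff)

lemma inv_lunit_nat:
  assumes "f \<in> Arr \<C>" "Dom \<C> f = A"
  shows "(\<one> \<I> \<otimes>\<^sub>a f) \<cdot> inv (lunit \<C> A) = inv (lunit \<C> (Cod \<C> f)) \<cdot> f"
proof (rule iso_cancel_left [where f = "lunit \<C> (Cod \<C> f)"])
  show "lunit \<C> (Cod \<C> f) \<cdot> ((\<one> \<I> \<otimes>\<^sub>a f) \<cdot> inv (lunit \<C> A))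
    = lunit \<C> (Cod \<C> f) \<cdot> (inv (lunit \<C> (Cod \<C> f)) \<cdot> f)"
    using assms comp_tail [OF lunit_nat, of f _ "inv (lunit \<C> A)"] by auto
qed (use assms in auto)

lemma inv_runit_nat:
  assumes "f \<in> Arr \<C>" "Dom \<C> f = A"
  shows "(f \<otimes>\<^sub>a \<one> \<I>) \<cdot> inv (runit \<C> A) = inv (runit \<C> (Cod \<C> f)) \<cdot> f"
proof (rule iso_cancel_left [where f = "runit \<C> (Cod \<C> f)"])
  show "runit \<C> (Cod \<C> f) \<cdot> ((f \<otimes>\<^sub>a \<one> \<I>) \<cdot> inv (runit \<C> A))
    = runit \<C> (Cod \<C> f) \<cdot> (inv (runit \<C> (Cod \<C> f)) \<cdot> f)"
    using assms comp_tail [OF runit_nat, of f _ "inv (runit \<C> A)"] by auto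
qed (use assms in auto)

lemma tensor_iso [simp]:
  assumes "iso_arrow \<C> f" "iso_arrow \<C> g"
  shows "iso_arrow \<C> (f \<otimes>\<^sub>a g)" "inv (f \<otimes>\<^sub>a g) = inv f \<otimes>\<^sub>a inv g"
proof -
  have "f \<otimes>\<^sub>a g \<in> hom \<C> (Dom \<C> f \<otimes> Dom \<C> g) (Cod \<C> f \<otimes> Cod \<C> g)"
    "inv f \<otimes>\<^sub>a inv g \<in> hom \<C> (Cod \<C> f \<otimes> Cod \<C> g) (Dom \<C> f \<otimes> Dom \<C> g)"
    "(inv f \<otimes>\<^sub>a inv g) \<cdot> (f \<otimes>\<^sub>a g) = \<one> (Dom \<C> f \<otimes> Dom \<C> g)"
    "(f \<otimes>\<^sub>a g) \<cdot> (inv f \<otimes>\<^sub>a inv g) = \<one> (Cod \<C> f \<otimes> Cod \<C> g)"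
    using assms by (simp_all add: in_hom_iff interchange)
  from inverse_arrow_eq [OF this]
  show "iso_arrow \<C> (f \<otimes>\<^sub>a g)" "inv (f \<otimes>\<^sub>a g) = inv f \<otimes>\<^sub>a inv g" .
qed

lemma ident_iso [simp]:
  assumes "A \<in> Ob \<C>"
  shows "iso_arrow \<C> (\<one> A)" "inv (\<one> A) = \<one> A"
  using inverse_arrow_eq [of "\<one> A" A A "\<one> A"] assms by (simp_all add: in_hom_iff)

lemma unit_tensor_faithful:
  assumes "f \<in> Arr \<C>" "g \<in> Arr \<C>" "Dom \<C> f = Dom \<C> g" "Cod \<C> f = Cod \<C> g"
    "\<one> \<I> \<otimes>\<^sub>a f = \<one> \<I> \<otimes>\<^sub>a g"
  shows "f = g"
proof (rule iso_cancel_right [where f = "lunit \<C> (Dom \<C> f)"])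
  show "f \<cdot> lunit \<C> (Dom \<C> f) = g \<cdot> lunit \<C> (Dom \<C> f)"
    using lunit_nat [of f] lunit_nat [of g] assms by simp
qed (use assms in auto)

text \<open>Kelly's observation that the pentagon and the triangle determine the unitors of a product.
  The functor \<open>I \<otimes> -\<close> is faithful, so it is enough to compare the two sides inside the pentagon
  on \<open>I, I, A, B\<close>.\<close>

lemma lunit_tensor:
  assumes "A \<in> Ob \<C>" "B \<in> Ob \<C>"
  shows "lunit \<C> (A \<otimes> B) \<cdot> assoc \<C> \<I> A B = lunit \<C> A \<otimes>\<^sub>a \<one> B"
proof (rule unit_tensor_faithful)
  let ?p = "assoc \<C> \<I> (\<I> \<otimes> A) B \<cdot> (assoc \<C> \<I> \<I> A \<otimes>\<^sub>a \<one> B)"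
  have "(\<one> \<I> \<otimes>\<^sub>a (lunit \<C> A \<otimes>\<^sub>a \<one> B)) \<cdot> ?p
    = assoc \<C> \<I> A B \<cdot> (((\<one> \<I> \<otimes>\<^sub>a lunit \<C> A) \<otimes>\<^sub>a \<one> B) \<cdot> (assoc \<C> \<I> \<I> A \<otimes>\<^sub>a \<one> B))"
    using assms by (simp add: assoc_nat_tail)
  also have "\<dots> = assoc \<C> \<I> A B \<cdot> ((runit \<C> \<I> \<otimes>\<^sub>a \<one> A) \<otimes>\<^sub>a \<one> B)"
    using assms by (simp add: interchange triangle)
  also have "\<dots> = (runit \<C> \<I> \<otimes>\<^sub>a \<one> (A \<otimes> B)) \<cdot> assoc \<C> (\<I> \<otimes> \<I>) A B"
    using assms by (simp add: assoc_nat)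
  also have "\<dots> = ((\<one> \<I> \<otimes>\<^sub>a lunit \<C> (A \<otimes> B)) \<cdot> assoc \<C> \<I> \<I> (A \<otimes> B)) \<cdot> assoc \<C> (\<I> \<otimes> \<I>) A B"
    using assms by (simp only: triangle tensor_ob_in_Ob unit_in_Ob)
  also have "\<dots> = (\<one> \<I> \<otimes>\<^sub>a lunit \<C> (A \<otimes> B)) \<cdot> ((\<one> \<I> \<otimes>\<^sub>a assoc \<C> \<I> A B) \<cdot> ?p)"
    using assms pentagon [of \<I> \<I> A B] by simp
  also have "\<dots> = (\<one> \<I> \<otimes>\<^sub>a (lunit \<C> (A \<otimes> B) \<cdot> assoc \<C> \<I> A B)) \<cdot> ?p"
    using assms by (simp add: interchange_tail)
  finally show "\<one> \<I> \<otimes>\<^sub>a (lunit \<C> (A \<otimes> B) \<cdot> assoc \<C> \<I> A B) = \<one> \<I> \<otimes>\<^sub>a (lunit \<C> A \<otimes>\<^sub>a \<one> B)"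
    by (rule iso_cancel_right [where f = ?p, OF _ _ _ _ _ sym, rotated -1]) (use assms in auto)
qed (use assms in auto)

end

lemma reversed_simps [simp]:
  fixes \<C> :: "('o, 'm, 'z) monoidal_data_scheme" (structure)
  shows "Ob (reversed \<C>) = Ob \<C>" "Arr (reversed \<C>) = Arr \<C>" "Dom (reversed \<C>) = Dom \<C>"
    "Cod (reversed \<C>) = Cod \<C>" "ident (reversed \<C>) = ident \<C>" "comp (reversed \<C>) = comp \<C>"
    "tensor_ob (reversed \<C>) A B = B \<otimes> A" "tensor_arr (reversed \<C>) f g = g \<otimes>\<^sub>a f"
    "unit_ob (reversed \<C>) = \<I>" "assoc (reversed \<C>) A B C = inv (assoc \<C> C B A)"
    "lunit (reversed \<C>) = runit \<C>" "runit (reversed \<C>) = lunit \<C>"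
    "hom (reversed \<C>) = hom \<C>" "iso_arrow (reversed \<C>) = iso_arrow \<C>"
    "inverse_arrow (reversed \<C>) = inverse_arrow \<C>"
proof -
  have i: "inverse_arrows (reversed \<C>) = inverse_arrows \<C>"
    by (intro ext) (simp add: inverse_arrows_def reversed_def hom_def)
  show "iso_arrow (reversed \<C>) = iso_arrow \<C>" "inverse_arrow (reversed \<C>) = inverse_arrow \<C>"
    by (intro ext; simp add: iso_arrow_def inverse_arrow_def i; simp add: reversed_def)+
qed (auto simp: reversed_def hom_def fun_eq_iff)

lemma (in monoidal_category) reversed_pentagon:
  assumes "A \<in> Ob \<C>" "B \<in> Ob \<C>" "C \<in> Ob \<C>" "D \<in> Ob \<C>"
  shows "(inv (assoc \<C> D C B) \<otimes>\<^sub>a \<one> A) \<cdot> (inv (assoc \<C> D (C \<otimes> B) A) \<cdot> (\<one> D \<otimes>\<^sub>a inv (assoc \<C> C B A)))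
    = inv (assoc \<C> (D \<otimes> C) B A) \<cdot> inv (assoc \<C> D C (B \<otimes> A))"
proof -
  let ?f = "assoc \<C> D C (B \<otimes> A) \<cdot> assoc \<C> (D \<otimes> C) B A"
  have "inv ?f = inv (assoc \<C> (D \<otimes> C) B A) \<cdot> inv (assoc \<C> D C (B \<otimes> A))"
    by (rule inverse_arrow_eq [of _ "((D \<otimes> C) \<otimes> B) \<otimes> A" "D \<otimes> (C \<otimes> (B \<otimes> A))"])
      (use assms in \<open>auto simp: in_hom_iff\<close>)
  moreover have "inv ((\<one> D \<otimes>\<^sub>a assoc \<C> C B A) \<cdot> assoc \<C> D (C \<otimes> B) A \<cdot> (assoc \<C> D C B \<otimes>\<^sub>a \<one> A))
    = (inv (assoc \<C> D C B) \<otimes>\<^sub>a \<one> A) \<cdot> (inv (assoc \<C> D (C \<otimes> B) A) \<cdot> (\<one> D \<otimes>\<^sub>a inv (assoc \<C> C B A)))"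
    by (rule inverse_arrow_eq [of _ "((D \<otimes> C) \<otimes> B) \<otimes> A" "D \<otimes> (C \<otimes> (B \<otimes> A))"])
      (use assms in \<open>auto simp: in_hom_iff interchange interchange_tail\<close>)
  ultimately show ?thesis
    using pentagon assms by simp
qed

text \<open>Passing to the reversed product exchanges left with right, so each argument about unitors and
  duals is needed on one side only.\<close>

lemma (in monoidal_category) reversed_monoidal: "monoidal_category (reversed \<C>)"
proof -
  have t: "(runit \<C> B \<otimes>\<^sub>a \<one> A) \<cdot> inv (assoc \<C> B \<I> A) = \<one> B \<otimes>\<^sub>a lunit \<C> A" 
    if "A \<in> Ob \<C>" "B \<in> Ob \<C>" for A B
    using that by (simp flip: triangle)
  show ?thesis
    by unfold_locales
      (simp_all add: in_hom_iff reversed_pentagon inv_assoc_nat interchange lunit_nat runit_nat t)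
qed

context monoidal_category
begin

lemma runit_tensor:
  assumes "A \<in> Ob \<C>" "B \<in> Ob \<C>"
  shows "(\<one> A \<otimes>\<^sub>a runit \<C> B) \<cdot> assoc \<C> A B \<I> = runit \<C> (A \<otimes> B)"
proof (rule iso_cancel_right [where f = "inv (assoc \<C> A B \<I>)"])
  interpret rev: monoidal_category "reversed \<C>"
    by (rule reversed_monoidal)
  show "((\<one> A \<otimes>\<^sub>a runit \<C> B) \<cdot> assoc \<C> A B \<I>) \<cdot> inv (assoc \<C> A B \<I>)
    = runit \<C> (A \<otimes> B) \<cdot> inv (assoc \<C> A B \<I>)"
    using assms rev.lunit_tensor [of B A] by simp
qed (use assms in auto)

text \<open>Naturality of the right unitor at itself gives \<open>runit (I \<otimes> I) = runit I \<otimes> I\<close>.  With the triangle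
  and the right unitor of \<open>I \<otimes> I\<close>, this identifies the two unitors after applying \<open>I \<otimes> -\<close>.\<close>

lemma lunit_eq_runit: "lunit \<C> \<I> = runit \<C> \<I>"
proof (rule unit_tensor_faithful)
  have "runit \<C> \<I> \<cdot> runit \<C> (\<I> \<otimes> \<I>) = runit \<C> \<I> \<cdot> (runit \<C> \<I> \<otimes>\<^sub>a \<one> \<I>)"
    by (simp add: runit_nat)
  then have "runit \<C> (\<I> \<otimes> \<I>) = runit \<C> \<I> \<otimes>\<^sub>a \<one> \<I>"
    by (rule iso_cancel_left [rotated -1]) auto
  then have "(\<one> \<I> \<otimes>\<^sub>a lunit \<C> \<I>) \<cdot> assoc \<C> \<I> \<I> \<I> = (\<one> \<I> \<otimes>\<^sub>a runit \<C> \<I>) \<cdot> assoc \<C> \<I> \<I> \<I>"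
    by (simp add: runit_tensor triangle)
  then show "\<one> \<I> \<otimes>\<^sub>a lunit \<C> \<I> = \<one> \<I> \<otimes>\<^sub>a runit \<C> \<I>"
    by (rule iso_cancel_right [rotated -1]) auto
qed auto


section \<open>Duals from universal evaluations\<close>

text \<open>An evaluation \<open>e : L \<otimes> R \<rightarrow> I\<close> exhibits \<open>L\<close> as a left dual of \<open>R\<close> as soon as each
  \<open>A \<otimes> e : A \<otimes> L \<otimes> R \<rightarrow> A\<close> exhibits \<open>A \<otimes> L\<close> as the value at \<open>A\<close> of a right adjoint of \<open>- \<otimes> R\<close>.
  Existence for \<open>A = R\<close>, \<open>X = I\<close> produces the coevaluation together with one zigzag equation.
  The other zigzag compares two arrows from \<open>L\<close> to \<open>I \<otimes> L\<close>; by uniqueness for \<open>A = I\<close>, \<open>X = L\<close> it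
  suffices to compare them after evaluation, where the first zigzag reduces the composite to \<open>e\<close>.
  Universality of \<open>e\<close> itself would only describe arrows into \<open>L\<close>, as for a dual with respect to a
  dualising object; the coevaluation needs it to persist after tensoring with \<open>R\<close>.\<close>

lemma dual_pair_of_universal_right:
  assumes L: "L \<in> Ob \<C>" and R: "R \<in> Ob \<C>" and e: "e \<in> hom \<C> (L \<otimes> R) \<I>"
    and universal: "\<And>A X. A \<in> Ob \<C> \<Longrightarrow> X \<in> Ob \<C> \<Longrightarrow>
      bij_betw (\<lambda>k. (\<one> A \<otimes>\<^sub>a e) \<cdot> assoc \<C> A L R \<cdot> (k \<otimes>\<^sub>a \<one> R)) (hom \<C> X (A \<otimes> L)) (hom \<C> (X \<otimes> R) (A \<otimes> \<I>))"
  shows "dual_pair \<C> L R"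
proof -
  have e': "e \<in> Arr \<C>" "Dom \<C> e = L \<otimes> R" "Cod \<C> e = \<I>"
    using e by (auto simp: in_hom_iff)
  have "inv (runit \<C> R) \<cdot> lunit \<C> R \<in> hom \<C> (\<I> \<otimes> R) (R \<otimes> \<I>)"
    using R by (simp add: in_hom_iff)
  then obtain n where n: "n \<in> hom \<C> \<I> (R \<otimes> L)"
    and zig: "(\<one> R \<otimes>\<^sub>a e) \<cdot> assoc \<C> R L R \<cdot> (n \<otimes>\<^sub>a \<one> R) = inv (runit \<C> R) \<cdot> lunit \<C> R"
    using universal [of R \<I>] R unfolding bij_betw_def image_iff by force
  have n': "n \<in> Arr \<C>" "Dom \<C> n = \<I>" "Cod \<C> n = R \<otimes> L"
    using n by (auto simp: in_hom_iff)
  let ?z = "(e \<otimes>\<^sub>a \<one> L) \<cdot> inv (assoc \<C> L R L) \<cdot> (\<one> L \<otimes>\<^sub>a n) \<cdot> inv (runit \<C> L)"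
  \<comment> \<open>The pentagon, solved for the rebracketing that lets the second evaluation meet \<open>n\<close>.\<close>
  have pent: "assoc \<C> (L \<otimes> R) L R \<cdot> (inv (assoc \<C> L R L) \<otimes>\<^sub>a \<one> R)
    = inv (assoc \<C> L R (L \<otimes> R)) \<cdot> ((\<one> L \<otimes>\<^sub>a assoc \<C> R L R) \<cdot> assoc \<C> L (R \<otimes> L) R)" (is "?lhs = ?rhs")
  proof (rule iso_cancel_left [where f = "assoc \<C> L R (L \<otimes> R)"])
    have "assoc \<C> L R (L \<otimes> R) \<cdot> ?lhs
      = (assoc \<C> L R (L \<otimes> R) \<cdot> assoc \<C> (L \<otimes> R) L R) \<cdot> (inv (assoc \<C> L R L) \<otimes>\<^sub>a \<one> R)"
      using L R by simp
    also have "\<dots> = ((\<one> L \<otimes>\<^sub>a assoc \<C> R L R) \<cdot> assoc \<C> L (R \<otimes> L) R \<cdot> (assoc \<C> L R L \<otimes>\<^sub>a \<one> R))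
        \<cdot> (inv (assoc \<C> L R L) \<otimes>\<^sub>a \<one> R)"
      using L R by (simp only: pentagon)
    also have "\<dots> = assoc \<C> L R (L \<otimes> R) \<cdot> ?rhs"
      using L R by (simp add: interchange)
    finally show "assoc \<C> L R (L \<otimes> R) \<cdot> ?lhs = assoc \<C> L R (L \<otimes> R) \<cdot> ?rhs" .
  qed (use L R in auto)
  have runit_inv: "inv (assoc \<C> L R \<I>) \<cdot> (\<one> L \<otimes>\<^sub>a inv (runit \<C> R)) = inv (runit \<C> (L \<otimes> R))"
  proof (rule iso_cancel_left [where f = "runit \<C> (L \<otimes> R)"])
    have "runit \<C> (L \<otimes> R) \<cdot> (inv (assoc \<C> L R \<I>) \<cdot> (\<one> L \<otimes>\<^sub>a inv (runit \<C> R)))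
      = (\<one> L \<otimes>\<^sub>a runit \<C> R) \<cdot> (\<one> L \<otimes>\<^sub>a inv (runit \<C> R))"
      using L R by (simp flip: runit_tensor)
    then show "runit \<C> (L \<otimes> R) \<cdot> (inv (assoc \<C> L R \<I>) \<cdot> (\<one> L \<otimes>\<^sub>a inv (runit \<C> R)))
      = runit \<C> (L \<otimes> R) \<cdot> inv (runit \<C> (L \<otimes> R))"
      using L R by (simp add: interchange)
  qed (use L R in auto)
  \<comment> \<open>Rebracketing brings the right-hand evaluation next to \<open>n\<close>, where the first zigzag applies.\<close>
  have merge: "(\<one> (L \<otimes> R) \<otimes>\<^sub>a e) \<cdot> (assoc \<C> (L \<otimes> R) L R \<cdot> ((inv (assoc \<C> L R L) \<otimes>\<^sub>a \<one> R)
      \<cdot> ((\<one> L \<otimes>\<^sub>a n) \<otimes>\<^sub>a \<one> R))) 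
    = inv (assoc \<C> L R \<I>) \<cdot> ((\<one> L \<otimes>\<^sub>a (inv (runit \<C> R) \<cdot> lunit \<C> R)) \<cdot> assoc \<C> L \<I> R)"
  proof -
    have "(\<one> (L \<otimes> R) \<otimes>\<^sub>a e) \<cdot> (assoc \<C> (L \<otimes> R) L R \<cdot> ((inv (assoc \<C> L R L) \<otimes>\<^sub>a \<one> R)
        \<cdot> ((\<one> L \<otimes>\<^sub>a n) \<otimes>\<^sub>a \<one> R)))
      = (((\<one> L \<otimes>\<^sub>a \<one> R) \<otimes>\<^sub>a e) \<cdot> inv (assoc \<C> L R (L \<otimes> R))) \<cdot> ((\<one> L \<otimes>\<^sub>a assoc \<C> R L R)
        \<cdot> (assoc \<C> L (R \<otimes> L) R \<cdot> ((\<one> L \<otimes>\<^sub>a n) \<otimes>\<^sub>a \<one> R)))"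
      using L R e' n' by (simp add: comp_tail [OF pent])
    also have "\<dots> = (inv (assoc \<C> L R \<I>) \<cdot> (\<one> L \<otimes>\<^sub>a (\<one> R \<otimes>\<^sub>a e))) \<cdot> ((\<one> L \<otimes>\<^sub>a assoc \<C> R L R)
        \<cdot> ((\<one> L \<otimes>\<^sub>a (n \<otimes>\<^sub>a \<one> R)) \<cdot> assoc \<C> L \<I> R))"
      using L R e' n' by (simp add: inv_assoc_nat assoc_nat del: tensor_ident)
    also have "\<dots> = inv (assoc \<C> L R \<I>)
        \<cdot> ((\<one> L \<otimes>\<^sub>a ((\<one> R \<otimes>\<^sub>a e) \<cdot> assoc \<C> R L R \<cdot> (n \<otimes>\<^sub>a \<one> R))) \<cdot> assoc \<C> L \<I> R)"
      using L R e' n' by (simp add: interchange_tail)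
    finally show ?thesis
      by (simp only: zig)
  qed
  have z: "?z = inv (lunit \<C> L)"
  proof (rule inj_onD [OF bij_betw_imp_inj_on [OF universal [of \<I> L]]])
    have "(\<one> \<I> \<otimes>\<^sub>a e) \<cdot> assoc \<C> \<I> L R \<cdot> (?z \<otimes>\<^sub>a \<one> R)
      = (\<one> \<I> \<otimes>\<^sub>a e) \<cdot> (assoc \<C> \<I> L R \<cdot> (((e \<otimes>\<^sub>a \<one> L) \<otimes>\<^sub>a \<one> R) \<cdot> ((inv (assoc \<C> L R L) \<otimes>\<^sub>a \<one> R)
        \<cdot> (((\<one> L \<otimes>\<^sub>a n) \<otimes>\<^sub>a \<one> R) \<cdot> (inv (runit \<C> L) \<otimes>\<^sub>a \<one> R)))))"
      using L R e' n' by (simp add: interchange)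
    \<comment> \<open>The two evaluations act on disjoint factors; the right-hand one is made to act first.\<close>
    also have "\<dots> = (e \<otimes>\<^sub>a \<one> \<I>) \<cdot> (((\<one> (L \<otimes> R) \<otimes>\<^sub>a e) \<cdot> (assoc \<C> (L \<otimes> R) L R \<cdot> ((inv (assoc \<C> L R L) \<otimes>\<^sub>a \<one> R)
        \<cdot> ((\<one> L \<otimes>\<^sub>a n) \<otimes>\<^sub>a \<one> R)))) \<cdot> (inv (runit \<C> L) \<otimes>\<^sub>a \<one> R))"
      using L R e' n' by (simp add: assoc_nat_tail) (simp add: interchange_tail)
    also have "\<dots> = ((e \<otimes>\<^sub>a \<one> \<I>) \<cdot> (inv (assoc \<C> L R \<I>) \<cdot> (\<one> L \<otimes>\<^sub>a inv (runit \<C> R))))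
        \<cdot> (((\<one> L \<otimes>\<^sub>a lunit \<C> R) \<cdot> assoc \<C> L \<I> R) \<cdot> (inv (runit \<C> L) \<otimes>\<^sub>a \<one> R))"
      unfolding merge using L R e' n' by (simp add: interchange_tail)
    also have "\<dots> = (e \<otimes>\<^sub>a \<one> \<I>) \<cdot> inv (runit \<C> (L \<otimes> R))"
      unfolding runit_inv triangle [OF L R] using L R e' n' by (simp add: interchange)
    also have "\<dots> = inv (lunit \<C> \<I>) \<cdot> e"
      using e' by (simp add: inv_runit_nat lunit_eq_runit)
    also have "\<dots> = (\<one> \<I> \<otimes>\<^sub>a e) \<cdot> inv (lunit \<C> (L \<otimes> R))"
      using e' by (simp add: inv_lunit_nat)
    also have "\<dots> = (\<one> \<I> \<otimes>\<^sub>a e) \<cdot> assoc \<C> \<I> L R \<cdot> (inv (lunit \<C> L) \<otimes>\<^sub>a \<one> R)"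
    proof -
      have "lunit \<C> (L \<otimes> R) \<cdot> (assoc \<C> \<I> L R \<cdot> (inv (lunit \<C> L) \<otimes>\<^sub>a \<one> R)) = \<one> (L \<otimes> R)"
        using L R comp_tail [OF lunit_tensor, of L R "inv (lunit \<C> L) \<otimes>\<^sub>a \<one> R"] by (simp add: interchange)
      then have "lunit \<C> (L \<otimes> R) \<cdot> (assoc \<C> \<I> L R \<cdot> (inv (lunit \<C> L) \<otimes>\<^sub>a \<one> R))
        = lunit \<C> (L \<otimes> R) \<cdot> inv (lunit \<C> (L \<otimes> R))"
        using L R by simp
      then have "assoc \<C> \<I> L R \<cdot> (inv (lunit \<C> L) \<otimes>\<^sub>a \<one> R) = inv (lunit \<C> (L \<otimes> R))"
        by (rule iso_cancel_left [rotated -1]) (use L R in auto)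
      then show ?thesis
        using L R e' by simp
    qed
    finally show "(\<one> \<I> \<otimes>\<^sub>a e) \<cdot> assoc \<C> \<I> L R \<cdot> (?z \<otimes>\<^sub>a \<one> R)
      = (\<one> \<I> \<otimes>\<^sub>a e) \<cdot> assoc \<C> \<I> L R \<cdot> (inv (lunit \<C> L) \<otimes>\<^sub>a \<one> R)" .
  qed (use L R e' n' in \<open>auto simp: in_hom_iff\<close>)
  have "lunit \<C> L \<cdot> (e \<otimes>\<^sub>a \<one> L) \<cdot> inv (assoc \<C> L R L) \<cdot> (\<one> L \<otimes>\<^sub>a n) \<cdot> inv (runit \<C> L) = lunit \<C> L \<cdot> ?z"
    using L R e' n' by simp
  moreover have "runit \<C> R \<cdot> (\<one> R \<otimes>\<^sub>a e) \<cdot> assoc \<C> R L R \<cdot> (n \<otimes>\<^sub>a \<one> R) \<cdot> inv (lunit \<C> R)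
    = runit \<C> R \<cdot> (((\<one> R \<otimes>\<^sub>a e) \<cdot> assoc \<C> R L R \<cdot> (n \<otimes>\<^sub>a \<one> R)) \<cdot> inv (lunit \<C> R))"
    using L R e' n' by simp
  ultimately show ?thesis
    unfolding dual_pair_def z zig using L R e n by (intro conjI bexI [of _ e] bexI [of _ n]) simp_all
qed

lemma dual_pair_of_universal_left:
  assumes L: "L \<in> Ob \<C>" and R: "R \<in> Ob \<C>" and e: "e \<in> hom \<C> (L \<otimes> R) \<I>"
    and universal: "\<And>A X. A \<in> Ob \<C> \<Longrightarrow> X \<in> Ob \<C> \<Longrightarrow>
      bij_betw (\<lambda>k. (e \<otimes>\<^sub>a \<one> A) \<cdot> inv (assoc \<C> L R A) \<cdot> (\<one> L \<otimes>\<^sub>a k)) (hom \<C> X (R \<otimes> A)) (hom \<C> (L \<otimes> X) (\<I> \<otimes> A))"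
  shows "dual_pair \<C> L R"
proof -
  interpret rev: monoidal_category "reversed \<C>"
    by (rule reversed_monoidal)
  have "dual_pair (reversed \<C>) R L"
    by (rule rev.dual_pair_of_universal_right [of R L e]) (use assms in simp_all)
  then show ?thesis
    using L R by (auto simp: dual_pair_def)
qed

end


section \<open>The duality functors and the product par\<close>

context star_autonomous_category
begin

declare bot_in_Ob [simp] rdual_in_Ob [simp] ldual_in_Ob [simp] bidual_lr_iso [simp] bidual_rl_iso [simp]

lemma ev_r_simps [simp]:
  assumes "A \<in> Ob \<C>"
  shows "ev_r \<C> A \<in> Arr \<C>" "Dom \<C> (ev_r \<C> A) = A \<otimes> rdual \<C> A" "Cod \<C> (ev_r \<C> A) = \<bottom>"
proof -
  have "ev_r \<C> A \<in> hom \<C> (A \<otimes> rdual \<C> A) \<bottom>"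
    unfolding ev_r_def by (rule bij_betwE [OF rtransp_bij, rule_format]) (use assms in \<open>simp_all add: in_hom_iff\<close>)
  then show "ev_r \<C> A \<in> Arr \<C>" "Dom \<C> (ev_r \<C> A) = A \<otimes> rdual \<C> A" "Cod \<C> (ev_r \<C> A) = \<bottom>"
    by (auto simp: in_hom_iff)
qed

lemma ev_l_simps [simp]:
  assumes "A \<in> Ob \<C>"
  shows "ev_l \<C> A \<in> Arr \<C>" "Dom \<C> (ev_l \<C> A) = ldual \<C> A \<otimes> A" "Cod \<C> (ev_l \<C> A) = \<bottom>"
proof -
  have "ev_l \<C> A \<in> hom \<C> (ldual \<C> A \<otimes> A) \<bottom>"
    unfolding ev_l_def by (rule bij_betwE [OF ltransp_bij, rule_format]) (use assms in \<open>simp_all add: in_hom_iff\<close>)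
  then show "ev_l \<C> A \<in> Arr \<C>" "Dom \<C> (ev_l \<C> A) = ldual \<C> A \<otimes> A" "Cod \<C> (ev_l \<C> A) = \<bottom>"
    by (auto simp: in_hom_iff)
qed

lemma rtransp_eq:
  assumes "A \<in> Ob \<C>" "f \<in> hom \<C> X (rdual \<C> A)"
  shows "rtransp \<C> A X f = ev_r \<C> A \<cdot> (\<one> A \<otimes>\<^sub>a f)"
  using rtransp_natural [of A "\<one> (rdual \<C> A)" "rdual \<C> A" f X] assms
  by (simp add: ev_r_def in_hom_iff)

lemma ltransp_eq:
  assumes "A \<in> Ob \<C>" "f \<in> hom \<C> X (ldual \<C> A)"
  shows "ltransp \<C> A X f = ev_l \<C> A \<cdot> (f \<otimes>\<^sub>a \<one> A)"
  using ltransp_natural [of A "\<one> (ldual \<C> A)" "ldual \<C> A" f X] assms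
  by (simp add: ev_l_def in_hom_iff)

lemma ev_r_universal_right:
  assumes "A \<in> Ob \<C>" "X \<in> Ob \<C>"
  shows "bij_betw (\<lambda>k. ev_r \<C> A \<cdot> (\<one> A \<otimes>\<^sub>a k)) (hom \<C> X (rdual \<C> A)) (hom \<C> (A \<otimes> X) \<bottom>)"
  using rtransp_bij [OF assms] assms by (simp add: rtransp_eq cong: bij_betw_cong)

lemma ev_l_universal_left:
  assumes "A \<in> Ob \<C>" "X \<in> Ob \<C>"
  shows "bij_betw (\<lambda>k. ev_l \<C> A \<cdot> (k \<otimes>\<^sub>a \<one> A)) (hom \<C> X (ldual \<C> A)) (hom \<C> (X \<otimes> A) \<bottom>)"
  using ltransp_bij [OF assms] assms by (simp add: ltransp_eq cong: bij_betw_cong)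

lemma runtransp_simps:
  assumes "A \<in> Ob \<C>" "h \<in> hom \<C> (A \<otimes> X) \<bottom>" "X \<in> Ob \<C>"
  shows "runtransp \<C> A X h \<in> hom \<C> X (rdual \<C> A)" "ev_r \<C> A \<cdot> (\<one> A \<otimes>\<^sub>a runtransp \<C> A X h) = h"
  using the_inv_into_props [OF rtransp_bij, OF assms(1,3,2)] assms
  by (simp_all add: runtransp_def flip: rtransp_eq)

lemma luntransp_simps:
  assumes "A \<in> Ob \<C>" "h \<in> hom \<C> (X \<otimes> A) \<bottom>" "X \<in> Ob \<C>"
  shows "luntransp \<C> A X h \<in> hom \<C> X (ldual \<C> A)" "ev_l \<C> A \<cdot> (luntransp \<C> A X h \<otimes>\<^sub>a \<one> A) = h"
  using the_inv_into_props [OF ltransp_bij, OF assms(1,3,2)] assms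
  by (simp_all add: luntransp_def flip: ltransp_eq)

lemma bidual_lr_simps [simp]:
  assumes "A \<in> Ob \<C>"
  shows "Dom \<C> (bidual_lr \<C> A) = A" "Cod \<C> (bidual_lr \<C> A) = ldual \<C> (rdual \<C> A)"
  using luntransp_simps(1) [of "rdual \<C> A" "ev_r \<C> A" A] assms
  by (simp_all add: bidual_lr_def in_hom_iff)

lemma bidual_rl_simps [simp]:
  assumes "A \<in> Ob \<C>"
  shows "Dom \<C> (bidual_rl \<C> A) = A" "Cod \<C> (bidual_rl \<C> A) = rdual \<C> (ldual \<C> A)"
  using runtransp_simps(1) [of "ldual \<C> A" "ev_l \<C> A" A] assms
  by (simp_all add: bidual_rl_def in_hom_iff)

lemma ev_l_bidual_lr: "A \<in> Ob \<C> \<Longrightarrow> ev_l \<C> (rdual \<C> A) \<cdot> (bidual_lr \<C> A \<otimes>\<^sub>a \<one> (rdual \<C> A)) = ev_r \<C> A"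
  by (simp add: bidual_lr_def luntransp_simps in_hom_iff)

lemma ev_r_bidual_rl: "A \<in> Ob \<C> \<Longrightarrow> ev_r \<C> (ldual \<C> A) \<cdot> (\<one> (ldual \<C> A) \<otimes>\<^sub>a bidual_rl \<C> A) = ev_l \<C> A"
  by (simp add: bidual_rl_def runtransp_simps in_hom_iff)

text \<open>Each evaluation is universal in both of its variables: in one by definition of the dual, in the
  other because the canonical map to the double dual is invertible.\<close>

lemma ev_r_universal_left:
  assumes "A \<in> Ob \<C>" "X \<in> Ob \<C>"
  shows "bij_betw (\<lambda>k. ev_r \<C> A \<cdot> (k \<otimes>\<^sub>a \<one> (rdual \<C> A))) (hom \<C> X A) (hom \<C> (X \<otimes> rdual \<C> A) \<bottom>)"
proof -
  have "bij_betw (\<lambda>k. ev_l \<C> (rdual \<C> A) \<cdot> ((bidual_lr \<C> A \<cdot> k) \<otimes>\<^sub>a \<one> (rdual \<C> A)))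
    (hom \<C> X A) (hom \<C> (X \<otimes> rdual \<C> A) \<bottom>)"
    by (rule bij_betw_trans [OF bij_betw_postcomp ev_l_universal_left, unfolded o_def])
      (use assms in \<open>auto simp: in_hom_iff\<close>)
  moreover have "ev_l \<C> (rdual \<C> A) \<cdot> ((bidual_lr \<C> A \<cdot> k) \<otimes>\<^sub>a \<one> (rdual \<C> A))
    = ev_r \<C> A \<cdot> (k \<otimes>\<^sub>a \<one> (rdual \<C> A))" if "k \<in> hom \<C> X A" for k
    using assms that by (simp add: in_hom_iff interchange flip: ev_l_bidual_lr)
  ultimately show ?thesis
    by (simp cong: bij_betw_cong)
qed

lemma ev_l_universal_right:
  assumes "A \<in> Ob \<C>" "X \<in> Ob \<C>"
  shows "bij_betw (\<lambda>k. ev_l \<C> A \<cdot> (\<one> (ldual \<C> A) \<otimes>\<^sub>a k)) (hom \<C> X A) (hom \<C> (ldual \<C> A \<otimes> X) \<bottom>)"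
proof -
  have "bij_betw (\<lambda>k. ev_r \<C> (ldual \<C> A) \<cdot> (\<one> (ldual \<C> A) \<otimes>\<^sub>a (bidual_rl \<C> A \<cdot> k)))
    (hom \<C> X A) (hom \<C> (ldual \<C> A \<otimes> X) \<bottom>)"
    by (rule bij_betw_trans [OF bij_betw_postcomp ev_r_universal_right, unfolded o_def])
      (use assms in \<open>auto simp: in_hom_iff\<close>)
  moreover have "ev_r \<C> (ldual \<C> A) \<cdot> (\<one> (ldual \<C> A) \<otimes>\<^sub>a (bidual_rl \<C> A \<cdot> k))
    = ev_l \<C> A \<cdot> (\<one> (ldual \<C> A) \<otimes>\<^sub>a k)" if "k \<in> hom \<C> X A" for k
    using assms that by (simp add: in_hom_iff interchange flip: ev_r_bidual_rl)
  ultimately show ?thesis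
    by (simp cong: bij_betw_cong)
qed

lemma ev_r_cancel_right:
  assumes "A \<in> Ob \<C>" "f \<in> Arr \<C>" "g \<in> Arr \<C>" "Dom \<C> f = Dom \<C> g" "Cod \<C> f = rdual \<C> A" "Cod \<C> g = rdual \<C> A"
    "ev_r \<C> A \<cdot> (\<one> A \<otimes>\<^sub>a f) = ev_r \<C> A \<cdot> (\<one> A \<otimes>\<^sub>a g)"
  shows "f = g"
  by (rule inj_onD [OF bij_betw_imp_inj_on [OF ev_r_universal_right [of A "Dom \<C> g"]]])
    (use assms in \<open>auto simp: in_hom_iff\<close>)

lemma ev_l_cancel_left:
  assumes "A \<in> Ob \<C>" "f \<in> Arr \<C>" "g \<in> Arr \<C>" "Dom \<C> f = Dom \<C> g" "Cod \<C> f = ldual \<C> A" "Cod \<C> g = ldual \<C> A"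
    "ev_l \<C> A \<cdot> (f \<otimes>\<^sub>a \<one> A) = ev_l \<C> A \<cdot> (g \<otimes>\<^sub>a \<one> A)"
  shows "f = g"
  by (rule inj_onD [OF bij_betw_imp_inj_on [OF ev_l_universal_left [of A "Dom \<C> g"]]])
    (use assms in \<open>auto simp: in_hom_iff\<close>)

lemma rdual_arr_simps [simp]:
  assumes "f \<in> Arr \<C>"
  shows "rdual_arr \<C> f \<in> Arr \<C>" "Dom \<C> (rdual_arr \<C> f) = rdual \<C> (Cod \<C> f)"
    "Cod \<C> (rdual_arr \<C> f) = rdual \<C> (Dom \<C> f)"
  using runtransp_simps(1) [of "Dom \<C> f" "ev_r \<C> (Cod \<C> f) \<cdot> (f \<otimes>\<^sub>a \<one> (rdual \<C> (Cod \<C> f)))"] assms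
  by (simp_all add: rdual_arr_def in_hom_iff)

lemma ldual_arr_simps [simp]:
  assumes "f \<in> Arr \<C>"
  shows "ldual_arr \<C> f \<in> Arr \<C>" "Dom \<C> (ldual_arr \<C> f) = ldual \<C> (Cod \<C> f)"
    "Cod \<C> (ldual_arr \<C> f) = ldual \<C> (Dom \<C> f)"
  using luntransp_simps(1) [of "Dom \<C> f" "ev_l \<C> (Cod \<C> f) \<cdot> (\<one> (ldual \<C> (Cod \<C> f)) \<otimes>\<^sub>a f)"] assms
  by (simp_all add: ldual_arr_def in_hom_iff)

lemma ev_r_rdual_arr:
  assumes "f \<in> Arr \<C>" "Dom \<C> f = A"
  shows "ev_r \<C> A \<cdot> (\<one> A \<otimes>\<^sub>a rdual_arr \<C> f) = ev_r \<C> (Cod \<C> f) \<cdot> (f \<otimes>\<^sub>a \<one> (rdual \<C> (Cod \<C> f)))"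
  unfolding rdual_arr_def assms(2) by (rule runtransp_simps(2)) (use assms in \<open>auto simp: in_hom_iff\<close>)

lemma ev_l_ldual_arr:
  assumes "f \<in> Arr \<C>" "Dom \<C> f = A"
  shows "ev_l \<C> A \<cdot> (ldual_arr \<C> f \<otimes>\<^sub>a \<one> A) = ev_l \<C> (Cod \<C> f) \<cdot> (\<one> (ldual \<C> (Cod \<C> f)) \<otimes>\<^sub>a f)"
  unfolding ldual_arr_def assms(2) by (rule luntransp_simps(2)) (use assms in \<open>auto simp: in_hom_iff\<close>)

text \<open>The arrow and its dual have the same pairing with the evaluations, and both pairings are
  bijective.  Full faithfulness of duality is what makes the traces for par well defined.\<close>

lemma rdual_arr_bij:
  assumes "A \<in> Ob \<C>" "B \<in> Ob \<C>"
  shows "bij_betw (rdual_arr \<C>) (hom \<C> A B) (hom \<C> (rdual \<C> B) (rdual \<C> A))"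
  by (rule bij_betw_factor [OF ev_r_universal_left [of B A] ev_r_universal_right [of A "rdual \<C> B"]])
    (use assms in \<open>auto simp: in_hom_iff ev_r_rdual_arr\<close>)

lemma ldual_arr_bij:
  assumes "A \<in> Ob \<C>" "B \<in> Ob \<C>"
  shows "bij_betw (ldual_arr \<C>) (hom \<C> A B) (hom \<C> (ldual \<C> B) (ldual \<C> A))"
  by (rule bij_betw_factor [OF ev_l_universal_right [of B A] ev_l_universal_left [of A "ldual \<C> B"]])
    (use assms in \<open>auto simp: in_hom_iff ev_l_ldual_arr\<close>)

lemma rdual_arr_ident [simp]:
  assumes "A \<in> Ob \<C>"
  shows "rdual_arr \<C> (\<one> A) = \<one> (rdual \<C> A)"
  by (rule ev_r_cancel_right [of A]) (use assms in \<open>auto simp: ev_r_rdual_arr\<close>)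

lemma ldual_arr_ident [simp]:
  assumes "A \<in> Ob \<C>"
  shows "ldual_arr \<C> (\<one> A) = \<one> (ldual \<C> A)"
  by (rule ev_l_cancel_left [of A]) (use assms in \<open>auto simp: ev_l_ldual_arr\<close>)

lemma rdual_arr_comp:
  assumes "f \<in> Arr \<C>" "g \<in> Arr \<C>" "Cod \<C> f = Dom \<C> g"
  shows "rdual_arr \<C> f \<cdot> rdual_arr \<C> g = rdual_arr \<C> (g \<cdot> f)"
proof (rule ev_r_cancel_right [of "Dom \<C> f"])
  let ?C = "Cod \<C> g"
  have "ev_r \<C> (Dom \<C> f) \<cdot> (\<one> (Dom \<C> f) \<otimes>\<^sub>a (rdual_arr \<C> f \<cdot> rdual_arr \<C> g))
    = (ev_r \<C> (Dom \<C> f) \<cdot> (\<one> (Dom \<C> f) \<otimes>\<^sub>a rdual_arr \<C> f)) \<cdot> (\<one> (Dom \<C> f) \<otimes>\<^sub>a rdual_arr \<C> g)"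
    using assms by (simp add: interchange)
  also have "\<dots> = ev_r \<C> (Cod \<C> f) \<cdot> ((\<one> (Cod \<C> f) \<otimes>\<^sub>a rdual_arr \<C> g) \<cdot> (f \<otimes>\<^sub>a \<one> (rdual \<C> ?C)))"
    using assms by (simp add: ev_r_rdual_arr interchange)
  also have "\<dots> = (ev_r \<C> (Dom \<C> g) \<cdot> (\<one> (Dom \<C> g) \<otimes>\<^sub>a rdual_arr \<C> g)) \<cdot> (f \<otimes>\<^sub>a \<one> (rdual \<C> ?C))"
    using assms by simp
  also have "\<dots> = ev_r \<C> (Dom \<C> f) \<cdot> (\<one> (Dom \<C> f) \<otimes>\<^sub>a rdual_arr \<C> (g \<cdot> f))"
    using assms by (simp add: ev_r_rdual_arr interchange)
  finally show "ev_r \<C> (Dom \<C> f) \<cdot> (\<one> (Dom \<C> f) \<otimes>\<^sub>a (rdual_arr \<C> f \<cdot> rdual_arr \<C> g))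
    = ev_r \<C> (Dom \<C> f) \<cdot> (\<one> (Dom \<C> f) \<otimes>\<^sub>a rdual_arr \<C> (g \<cdot> f))" .
qed (use assms in auto)

lemma ldual_arr_comp:
  assumes "f \<in> Arr \<C>" "g \<in> Arr \<C>" "Cod \<C> f = Dom \<C> g"
  shows "ldual_arr \<C> f \<cdot> ldual_arr \<C> g = ldual_arr \<C> (g \<cdot> f)"
proof (rule ev_l_cancel_left [of "Dom \<C> f"])
  let ?C = "Cod \<C> g"
  have "ev_l \<C> (Dom \<C> f) \<cdot> ((ldual_arr \<C> f \<cdot> ldual_arr \<C> g) \<otimes>\<^sub>a \<one> (Dom \<C> f))
    = (ev_l \<C> (Dom \<C> f) \<cdot> (ldual_arr \<C> f \<otimes>\<^sub>a \<one> (Dom \<C> f))) \<cdot> (ldual_arr \<C> g \<otimes>\<^sub>a \<one> (Dom \<C> f))"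
    using assms by (simp add: interchange)
  also have "\<dots> = ev_l \<C> (Cod \<C> f) \<cdot> ((ldual_arr \<C> g \<otimes>\<^sub>a \<one> (Cod \<C> f)) \<cdot> (\<one> (ldual \<C> ?C) \<otimes>\<^sub>a f))"
    using assms by (simp add: ev_l_ldual_arr interchange)
  also have "\<dots> = (ev_l \<C> (Dom \<C> g) \<cdot> (ldual_arr \<C> g \<otimes>\<^sub>a \<one> (Dom \<C> g))) \<cdot> (\<one> (ldual \<C> ?C) \<otimes>\<^sub>a f)"
    using assms by simp
  also have "\<dots> = ev_l \<C> (Dom \<C> f) \<cdot> (ldual_arr \<C> (g \<cdot> f) \<otimes>\<^sub>a \<one> (Dom \<C> f))"
    using assms by (simp add: ev_l_ldual_arr interchange)
  finally show "ev_l \<C> (Dom \<C> f) \<cdot> ((ldual_arr \<C> f \<cdot> ldual_arr \<C> g) \<otimes>\<^sub>a \<one> (Dom \<C> f))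
    = ev_l \<C> (Dom \<C> f) \<cdot> (ldual_arr \<C> (g \<cdot> f) \<otimes>\<^sub>a \<one> (Dom \<C> f))" .
qed (use assms in auto)

lemma rdual_arr_iso [simp]:
  assumes "iso_arrow \<C> f"
  shows "iso_arrow \<C> (rdual_arr \<C> f)"
  by (rule inverse_arrow_eq(1) [of _ "rdual \<C> (Cod \<C> f)" "rdual \<C> (Dom \<C> f)" "rdual_arr \<C> (inv f)"])
    (use assms in \<open>auto simp: in_hom_iff rdual_arr_comp\<close>)

lemma ldual_arr_iso [simp]:
  assumes "iso_arrow \<C> f"
  shows "iso_arrow \<C> (ldual_arr \<C> f)"
  by (rule inverse_arrow_eq(1) [of _ "ldual \<C> (Cod \<C> f)" "ldual \<C> (Dom \<C> f)" "ldual_arr \<C> (inv f)"])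
    (use assms in \<open>auto simp: in_hom_iff ldual_arr_comp\<close>)

lemma par_ob_in_Ob [simp]: "A \<in> Ob \<C> \<Longrightarrow> B \<in> Ob \<C> \<Longrightarrow> A \<bindnasrepma> B \<in> Ob \<C>"
  by (simp add: par_ob_def)

lemma par_arr_simps [simp]:
  assumes "f \<in> Arr \<C>" "g \<in> Arr \<C>"
  shows "f \<bindnasrepma>\<^sub>a g \<in> Arr \<C>" "Dom \<C> (f \<bindnasrepma>\<^sub>a g) = Dom \<C> f \<bindnasrepma> Dom \<C> g"
    "Cod \<C> (f \<bindnasrepma>\<^sub>a g) = Cod \<C> f \<bindnasrepma> Cod \<C> g"
  using assms by (simp_all add: par_arr_def par_ob_def)

lemma par_arr_ident [simp]: "A \<in> Ob \<C> \<Longrightarrow> B \<in> Ob \<C> \<Longrightarrow> \<one> A \<bindnasrepma>\<^sub>a \<one> B = \<one> (A \<bindnasrepma> B)"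
  by (simp add: par_arr_def par_ob_def)

lemma par_arr_iso [simp]: "iso_arrow \<C> f \<Longrightarrow> iso_arrow \<C> g \<Longrightarrow> iso_arrow \<C> (f \<bindnasrepma>\<^sub>a g)"
  by (simp add: par_arr_def)


section \<open>Counits, transposes and linear distributors\<close>

lemma counit_r_props:
  assumes "A \<in> Ob \<C>" "B \<in> Ob \<C>"
  shows "counit_r \<C> A B \<in> hom \<C> ((A \<bindnasrepma> B) \<otimes> rdual \<C> B) A"
    and "ev_r \<C> A \<cdot> (counit_r \<C> A B \<otimes>\<^sub>a \<one> (rdual \<C> A))
      = ev_l \<C> (rdual \<C> B \<otimes> rdual \<C> A) \<cdot> assoc \<C> (A \<bindnasrepma> B) (rdual \<C> B) (rdual \<C> A)"
proof -
  define h where "h = ev_l \<C> (rdual \<C> B \<otimes> rdual \<C> A) \<cdot> assoc \<C> (A \<bindnasrepma> B) (rdual \<C> B) (rdual \<C> A)"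
  define l where "l = luntransp \<C> (rdual \<C> A) ((A \<bindnasrepma> B) \<otimes> rdual \<C> B) h"
  have "h \<in> hom \<C> (((A \<bindnasrepma> B) \<otimes> rdual \<C> B) \<otimes> rdual \<C> A) \<bottom>"
    using assms by (simp add: h_def in_hom_iff par_ob_def)
  then have l: "l \<in> hom \<C> ((A \<bindnasrepma> B) \<otimes> rdual \<C> B) (ldual \<C> (rdual \<C> A))"
    "ev_l \<C> (rdual \<C> A) \<cdot> (l \<otimes>\<^sub>a \<one> (rdual \<C> A)) = h"
    using assms by (simp_all add: l_def luntransp_simps)
  have c: "counit_r \<C> A B = inv (bidual_lr \<C> A) \<cdot> l"
    by (simp add: counit_r_def l_def h_def)
  show "counit_r \<C> A B \<in> hom \<C> ((A \<bindnasrepma> B) \<otimes> rdual \<C> B) A"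
    using assms l(1) by (simp add: c in_hom_iff)
  have "ev_r \<C> A \<cdot> (counit_r \<C> A B \<otimes>\<^sub>a \<one> (rdual \<C> A)) = ev_l \<C> (rdual \<C> A) \<cdot> (l \<otimes>\<^sub>a \<one> (rdual \<C> A))"
    using assms l(1) by (simp add: c in_hom_iff interchange flip: ev_l_bidual_lr)
  then show "ev_r \<C> A \<cdot> (counit_r \<C> A B \<otimes>\<^sub>a \<one> (rdual \<C> A))
      = ev_l \<C> (rdual \<C> B \<otimes> rdual \<C> A) \<cdot> assoc \<C> (A \<bindnasrepma> B) (rdual \<C> B) (rdual \<C> A)"
    by (simp add: l(2) h_def)
qed

lemma counit_r_simps [simp]:
  assumes "A \<in> Ob \<C>" "B \<in> Ob \<C>"
  shows "counit_r \<C> A B \<in> Arr \<C>" "Dom \<C> (counit_r \<C> A B) = (A \<bindnasrepma> B) \<otimes> rdual \<C> B"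
    "Cod \<C> (counit_r \<C> A B) = A"
  using counit_r_props(1) [OF assms] by (auto simp: in_hom_iff)

lemma counit_l_props:
  assumes "A \<in> Ob \<C>" "B \<in> Ob \<C>"
  shows "counit_l \<C> A B \<in> hom \<C> (ldual \<C> A \<otimes> (A \<bindnasrepma> B)) B"
    and "ev_r \<C> B \<cdot> (counit_l \<C> A B \<otimes>\<^sub>a \<one> (rdual \<C> B))
      = ev_l \<C> A \<cdot> (\<one> (ldual \<C> A) \<otimes>\<^sub>a counit_r \<C> A B) \<cdot> assoc \<C> (ldual \<C> A) (A \<bindnasrepma> B) (rdual \<C> B)"
proof -
  define h where "h = ev_l \<C> A \<cdot> (\<one> (ldual \<C> A) \<otimes>\<^sub>a counit_r \<C> A B) \<cdot> assoc \<C> (ldual \<C> A) (A \<bindnasrepma> B) (rdual \<C> B)"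
  define l where "l = luntransp \<C> (rdual \<C> B) (ldual \<C> A \<otimes> (A \<bindnasrepma> B)) h"
  have "h \<in> hom \<C> ((ldual \<C> A \<otimes> (A \<bindnasrepma> B)) \<otimes> rdual \<C> B) \<bottom>"
    using assms by (simp add: h_def in_hom_iff)
  then have l: "l \<in> hom \<C> (ldual \<C> A \<otimes> (A \<bindnasrepma> B)) (ldual \<C> (rdual \<C> B))"
    "ev_l \<C> (rdual \<C> B) \<cdot> (l \<otimes>\<^sub>a \<one> (rdual \<C> B)) = h"
    using assms by (simp_all add: l_def luntransp_simps)
  have c: "counit_l \<C> A B = inv (bidual_lr \<C> B) \<cdot> l"
    by (simp add: counit_l_def l_def h_def)
  show "counit_l \<C> A B \<in> hom \<C> (ldual \<C> A \<otimes> (A \<bindnasrepma> B)) B"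
    using assms l(1) by (simp add: c in_hom_iff)
  have "ev_r \<C> B \<cdot> (counit_l \<C> A B \<otimes>\<^sub>a \<one> (rdual \<C> B)) = ev_l \<C> (rdual \<C> B) \<cdot> (l \<otimes>\<^sub>a \<one> (rdual \<C> B))"
    using assms l(1) by (simp add: c in_hom_iff interchange flip: ev_l_bidual_lr)
  then show "ev_r \<C> B \<cdot> (counit_l \<C> A B \<otimes>\<^sub>a \<one> (rdual \<C> B))
      = ev_l \<C> A \<cdot> (\<one> (ldual \<C> A) \<otimes>\<^sub>a counit_r \<C> A B) \<cdot> assoc \<C> (ldual \<C> A) (A \<bindnasrepma> B) (rdual \<C> B)"
    by (simp only: l(2) h_def)
qed

lemma counit_l_simps [simp]:
  assumes "A \<in> Ob \<C>" "B \<in> Ob \<C>"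
  shows "counit_l \<C> A B \<in> Arr \<C>" "Dom \<C> (counit_l \<C> A B) = ldual \<C> A \<otimes> (A \<bindnasrepma> B)"
    "Cod \<C> (counit_l \<C> A B) = B"
  using counit_l_props(1) [OF assms] by (auto simp: in_hom_iff)

text \<open>Following the counit by the evaluation of \<open>A\<close> gives, up to rebracketing, the evaluation that
  defines \<open>A \<bindnasrepma> B\<close> as a dual.  Since both evaluations are universal, so is the counit.\<close>

lemma counit_r_universal:
  assumes "A \<in> Ob \<C>" "B \<in> Ob \<C>" "X \<in> Ob \<C>"
  shows "bij_betw (\<lambda>k. counit_r \<C> A B \<cdot> (k \<otimes>\<^sub>a \<one> (rdual \<C> B))) (hom \<C> X (A \<bindnasrepma> B)) (hom \<C> (X \<otimes> rdual \<C> B) A)"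
proof (rule bij_betw_factor)
  let ?P = "rdual \<C> B \<otimes> rdual \<C> A" and ?a = "assoc \<C> X (rdual \<C> B) (rdual \<C> A)"
  show "bij_betw (\<lambda>k. (ev_l \<C> ?P \<cdot> (k \<otimes>\<^sub>a \<one> ?P)) \<cdot> ?a) (hom \<C> X (A \<bindnasrepma> B))
    (hom \<C> ((X \<otimes> rdual \<C> B) \<otimes> rdual \<C> A) \<bottom>)"
    unfolding par_ob_def
    by (rule bij_betw_trans [OF ev_l_universal_left bij_betw_precomp, unfolded o_def])
      (use assms in \<open>auto simp: in_hom_iff\<close>)
  show "bij_betw (\<lambda>k. ev_r \<C> A \<cdot> (k \<otimes>\<^sub>a \<one> (rdual \<C> A))) (hom \<C> (X \<otimes> rdual \<C> B) A)
    (hom \<C> ((X \<otimes> rdual \<C> B) \<otimes> rdual \<C> A) \<bottom>)"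
    using assms by (intro ev_r_universal_left) auto
  fix k assume k: "k \<in> hom \<C> X (A \<bindnasrepma> B)"
  then show "counit_r \<C> A B \<cdot> (k \<otimes>\<^sub>a \<one> (rdual \<C> B)) \<in> hom \<C> (X \<otimes> rdual \<C> B) A"
    using assms by (simp add: in_hom_iff)
  have "ev_r \<C> A \<cdot> ((counit_r \<C> A B \<cdot> (k \<otimes>\<^sub>a \<one> (rdual \<C> B))) \<otimes>\<^sub>a \<one> (rdual \<C> A))
    = (ev_r \<C> A \<cdot> (counit_r \<C> A B \<otimes>\<^sub>a \<one> (rdual \<C> A))) \<cdot> ((k \<otimes>\<^sub>a \<one> (rdual \<C> B)) \<otimes>\<^sub>a \<one> (rdual \<C> A))"
    using assms k by (simp add: in_hom_iff interchange)
  also have "\<dots> = (ev_l \<C> ?P \<cdot> assoc \<C> (A \<bindnasrepma> B) (rdual \<C> B) (rdual \<C> A))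
      \<cdot> ((k \<otimes>\<^sub>a \<one> (rdual \<C> B)) \<otimes>\<^sub>a \<one> (rdual \<C> A))"
    using assms by (simp only: counit_r_props)
  also have "\<dots> = (ev_l \<C> ?P \<cdot> (k \<otimes>\<^sub>a \<one> ?P)) \<cdot> ?a"
    using assms k by (simp add: in_hom_iff assoc_nat par_ob_def)
  finally show "ev_r \<C> A \<cdot> ((counit_r \<C> A B \<cdot> (k \<otimes>\<^sub>a \<one> (rdual \<C> B))) \<otimes>\<^sub>a \<one> (rdual \<C> A))
    = (ev_l \<C> ?P \<cdot> (k \<otimes>\<^sub>a \<one> ?P)) \<cdot> ?a" .
qed

text \<open>The left counit is defined through the right one, so its universality is derived from that of
  \<open>counit_r\<close> by pairing with \<open>B\<^sup>\<bottom>\<close> on one side and with \<open>\<^sup>\<bottom>A\<close> on the other.\<close>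

lemma counit_l_universal:
  assumes "A \<in> Ob \<C>" "B \<in> Ob \<C>" "X \<in> Ob \<C>"
  shows "bij_betw (\<lambda>k. counit_l \<C> A B \<cdot> (\<one> (ldual \<C> A) \<otimes>\<^sub>a k)) (hom \<C> X (A \<bindnasrepma> B)) (hom \<C> (ldual \<C> A \<otimes> X) B)"
proof (rule bij_betw_factor)
  let ?a = "assoc \<C> (ldual \<C> A) X (rdual \<C> B)"
  let ?r = "\<lambda>k. counit_r \<C> A B \<cdot> (k \<otimes>\<^sub>a \<one> (rdual \<C> B))"
  have "bij_betw (\<lambda>k. ev_l \<C> A \<cdot> (\<one> (ldual \<C> A) \<otimes>\<^sub>a ?r k)) (hom \<C> X (A \<bindnasrepma> B))
    (hom \<C> (ldual \<C> A \<otimes> (X \<otimes> rdual \<C> B)) \<bottom>)"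
    by (rule bij_betw_trans [OF counit_r_universal ev_l_universal_right, unfolded o_def])
      (use assms in auto)
  then show "bij_betw (\<lambda>k. (ev_l \<C> A \<cdot> (\<one> (ldual \<C> A) \<otimes>\<^sub>a ?r k)) \<cdot> ?a) (hom \<C> X (A \<bindnasrepma> B))
    (hom \<C> ((ldual \<C> A \<otimes> X) \<otimes> rdual \<C> B) \<bottom>)"
    by (rule bij_betw_trans [OF _ bij_betw_precomp, unfolded o_def])
      (use assms in \<open>auto simp: in_hom_iff\<close>)
  show "bij_betw (\<lambda>k. ev_r \<C> B \<cdot> (k \<otimes>\<^sub>a \<one> (rdual \<C> B))) (hom \<C> (ldual \<C> A \<otimes> X) B)
    (hom \<C> ((ldual \<C> A \<otimes> X) \<otimes> rdual \<C> B) \<bottom>)"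
    using assms by (intro ev_r_universal_left) auto
  fix k assume k: "k \<in> hom \<C> X (A \<bindnasrepma> B)"
  then show "counit_l \<C> A B \<cdot> (\<one> (ldual \<C> A) \<otimes>\<^sub>a k) \<in> hom \<C> (ldual \<C> A \<otimes> X) B"
    using assms by (simp add: in_hom_iff)
  have "ev_r \<C> B \<cdot> ((counit_l \<C> A B \<cdot> (\<one> (ldual \<C> A) \<otimes>\<^sub>a k)) \<otimes>\<^sub>a \<one> (rdual \<C> B))
    = (ev_r \<C> B \<cdot> (counit_l \<C> A B \<otimes>\<^sub>a \<one> (rdual \<C> B))) \<cdot> ((\<one> (ldual \<C> A) \<otimes>\<^sub>a k) \<otimes>\<^sub>a \<one> (rdual \<C> B))"
    using assms k by (simp add: in_hom_iff interchange)
  also have "\<dots> = (ev_l \<C> A \<cdot> (\<one> (ldual \<C> A) \<otimes>\<^sub>a counit_r \<C> A B)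
      \<cdot> assoc \<C> (ldual \<C> A) (A \<bindnasrepma> B) (rdual \<C> B)) \<cdot> ((\<one> (ldual \<C> A) \<otimes>\<^sub>a k) \<otimes>\<^sub>a \<one> (rdual \<C> B))"
    using assms by (simp only: counit_l_props)
  also have "\<dots> = (ev_l \<C> A \<cdot> (\<one> (ldual \<C> A) \<otimes>\<^sub>a ?r k)) \<cdot> ?a"
    using assms k by (simp add: in_hom_iff assoc_nat interchange_tail)
  finally show "ev_r \<C> B \<cdot> ((counit_l \<C> A B \<cdot> (\<one> (ldual \<C> A) \<otimes>\<^sub>a k)) \<otimes>\<^sub>a \<one> (rdual \<C> B))
    = (ev_l \<C> A \<cdot> (\<one> (ldual \<C> A) \<otimes>\<^sub>a ?r k)) \<cdot> ?a" .
qed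

lemma transpose_r_bij:
  assumes "A \<in> Ob \<C>" "Y \<in> Ob \<C>" "M \<in> Ob \<C>"
  shows "bij_betw (\<lambda>k. counit_r \<C> M (ldual \<C> Y) \<cdot> (k \<otimes>\<^sub>a bidual_rl \<C> Y))
    (hom \<C> A (M \<bindnasrepma> ldual \<C> Y)) (hom \<C> (A \<otimes> Y) M)"
proof -
  have "bij_betw (\<lambda>k. (counit_r \<C> M (ldual \<C> Y) \<cdot> (k \<otimes>\<^sub>a \<one> (rdual \<C> (ldual \<C> Y)))) \<cdot> (\<one> A \<otimes>\<^sub>a bidual_rl \<C> Y))
    (hom \<C> A (M \<bindnasrepma> ldual \<C> Y)) (hom \<C> (A \<otimes> Y) M)"
    by (rule bij_betw_trans [OF counit_r_universal bij_betw_precomp, unfolded o_def])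
      (use assms in \<open>auto simp: in_hom_iff\<close>)
  then show ?thesis
    by (rule bij_betw_cong [THEN iffD1, rotated]) (use assms in \<open>simp add: in_hom_iff interchange\<close>)
qed

lemma transpose_l_bij:
  assumes "A \<in> Ob \<C>" "Y \<in> Ob \<C>" "M \<in> Ob \<C>"
  shows "bij_betw (\<lambda>k. counit_l \<C> (rdual \<C> Y) M \<cdot> (bidual_lr \<C> Y \<otimes>\<^sub>a k))
    (hom \<C> A (rdual \<C> Y \<bindnasrepma> M)) (hom \<C> (Y \<otimes> A) M)"
proof -
  have "bij_betw (\<lambda>k. (counit_l \<C> (rdual \<C> Y) M \<cdot> (\<one> (ldual \<C> (rdual \<C> Y)) \<otimes>\<^sub>a k)) \<cdot> (bidual_lr \<C> Y \<otimes>\<^sub>a \<one> A))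
    (hom \<C> A (rdual \<C> Y \<bindnasrepma> M)) (hom \<C> (Y \<otimes> A) M)"
    by (rule bij_betw_trans [OF counit_l_universal bij_betw_precomp, unfolded o_def])
      (use assms in \<open>auto simp: in_hom_iff\<close>)
  then show ?thesis
    by (rule bij_betw_cong [THEN iffD1, rotated]) (use assms in \<open>simp add: in_hom_iff interchange\<close>)
qed

lemma transpose_r_props:
  assumes "A \<in> Ob \<C>" "Y \<in> Ob \<C>" "w \<in> hom \<C> (A \<otimes> Y) M"
  shows "transpose_r \<C> A Y M w \<in> hom \<C> A (M \<bindnasrepma> ldual \<C> Y)"
    "counit_r \<C> M (ldual \<C> Y) \<cdot> (transpose_r \<C> A Y M w \<otimes>\<^sub>a bidual_rl \<C> Y) = w"
  using the_inv_into_props [OF transpose_r_bij [of A Y M] assms(3)] assms in_homE(5) [OF assms(3)]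
  by (simp_all add: transpose_r_def)

lemma transpose_l_props:
  assumes "A \<in> Ob \<C>" "Y \<in> Ob \<C>" "w \<in> hom \<C> (Y \<otimes> A) M"
  shows "transpose_l \<C> A Y M w \<in> hom \<C> A (rdual \<C> Y \<bindnasrepma> M)"
    "counit_l \<C> (rdual \<C> Y) M \<cdot> (bidual_lr \<C> Y \<otimes>\<^sub>a transpose_l \<C> A Y M w) = w"
  using the_inv_into_props [OF transpose_l_bij [of A Y M] assms(3)] assms in_homE(5) [OF assms(3)]
  by (simp_all add: transpose_l_def)

lemma coev_simps [simp]:
  assumes "D \<in> Ob \<C>"
  shows "coev_r \<C> D \<in> Arr \<C>" "Dom \<C> (coev_r \<C> D) = \<I>" "Cod \<C> (coev_r \<C> D) = D \<bindnasrepma> ldual \<C> D"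
    "coev_l \<C> D \<in> Arr \<C>" "Dom \<C> (coev_l \<C> D) = \<I>" "Cod \<C> (coev_l \<C> D) = rdual \<C> D \<bindnasrepma> D"
  using transpose_r_props(1) [of \<I> D "lunit \<C> D" D] transpose_l_props(1) [of \<I> D "runit \<C> D" D] assms
  by (simp_all add: coev_r_def coev_l_def in_hom_iff)

text \<open>The distributor is a transpose followed by a par of isomorphisms; the transpose \<open>t\<close> is the part
  with a universal characterisation, and it is invertible exactly when the distributor is.\<close>

lemma delta_L_factor:
  assumes "A \<in> Ob \<C>" "B \<in> Ob \<C>" "C \<in> Ob \<C>"
  obtains t where "t \<in> hom \<C> (A \<otimes> (B \<bindnasrepma> C)) ((A \<otimes> B) \<bindnasrepma> ldual \<C> (rdual \<C> C))"
    "counit_r \<C> (A \<otimes> B) (ldual \<C> (rdual \<C> C)) \<cdot> (t \<otimes>\<^sub>a bidual_rl \<C> (rdual \<C> C))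
      = (\<one> A \<otimes>\<^sub>a counit_r \<C> B C) \<cdot> assoc \<C> A (B \<bindnasrepma> C) (rdual \<C> C)"
    "delta_L \<C> A B C = (\<one> (A \<otimes> B) \<bindnasrepma>\<^sub>a inv (bidual_lr \<C> C)) \<cdot> t"
proof -
  have "(\<one> A \<otimes>\<^sub>a counit_r \<C> B C) \<cdot> assoc \<C> A (B \<bindnasrepma> C) (rdual \<C> C)
      \<in> hom \<C> ((A \<otimes> (B \<bindnasrepma> C)) \<otimes> rdual \<C> C) (A \<otimes> B)"
    using assms by (simp add: in_hom_iff)
  from that [OF transpose_r_props [OF _ _ this] delta_L_def] show thesis
    using assms by simp
qed

lemma delta_R_factor:
  assumes "A \<in> Ob \<C>" "B \<in> Ob \<C>" "C \<in> Ob \<C>"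
  obtains t where "t \<in> hom \<C> ((A \<bindnasrepma> B) \<otimes> C) (rdual \<C> (ldual \<C> A) \<bindnasrepma> (B \<otimes> C))"
    "counit_l \<C> (rdual \<C> (ldual \<C> A)) (B \<otimes> C) \<cdot> (bidual_lr \<C> (ldual \<C> A) \<otimes>\<^sub>a t)
      = (counit_l \<C> A B \<otimes>\<^sub>a \<one> C) \<cdot> inv (assoc \<C> (ldual \<C> A) (A \<bindnasrepma> B) C)"
    "delta_R \<C> A B C = (inv (bidual_rl \<C> A) \<bindnasrepma>\<^sub>a \<one> (B \<otimes> C)) \<cdot> t"
proof -
  have "(counit_l \<C> A B \<otimes>\<^sub>a \<one> C) \<cdot> inv (assoc \<C> (ldual \<C> A) (A \<bindnasrepma> B) C)
      \<in> hom \<C> (ldual \<C> A \<otimes> ((A \<bindnasrepma> B) \<otimes> C)) (B \<otimes> C)"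
    using assms by (simp add: in_hom_iff)
  from that [OF transpose_l_props [OF _ _ this] delta_R_def] show thesis
    using assms by simp
qed

lemma delta_L_simps [simp]:
  assumes "A \<in> Ob \<C>" "B \<in> Ob \<C>" "C \<in> Ob \<C>"
  shows "delta_L \<C> A B C \<in> Arr \<C>" "Dom \<C> (delta_L \<C> A B C) = A \<otimes> (B \<bindnasrepma> C)"
    "Cod \<C> (delta_L \<C> A B C) = (A \<otimes> B) \<bindnasrepma> C"
  by (rule delta_L_factor [OF assms]; use assms in \<open>simp add: in_hom_iff\<close>)+

lemma delta_R_simps [simp]:
  assumes "A \<in> Ob \<C>" "B \<in> Ob \<C>" "C \<in> Ob \<C>"
  shows "delta_R \<C> A B C \<in> Arr \<C>" "Dom \<C> (delta_R \<C> A B C) = (A \<bindnasrepma> B) \<otimes> C"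
    "Cod \<C> (delta_R \<C> A B C) = A \<bindnasrepma> (B \<otimes> C)"
  by (rule delta_R_factor [OF assms]; use assms in \<open>simp add: in_hom_iff\<close>)+


section \<open>Duals from invertible distributors\<close>

text \<open>In any *-autonomous category \<open>M \<bindnasrepma> \<^sup>\<bottom>R\<close> is the value at \<open>M\<close> of the right adjoint of \<open>- \<otimes> R\<close>.  An
  invertible distributor \<open>A \<otimes> (I \<bindnasrepma> \<^sup>\<bottom>R) \<rightarrow> A \<bindnasrepma> \<^sup>\<bottom>R\<close> says that this right adjoint is tensoring with
  \<open>I \<bindnasrepma> \<^sup>\<bottom>R\<close>, and that its counit at \<open>A\<close> is \<open>A\<close> tensored with its counit at \<open>I\<close>.\<close>

lemma left_dual_of_invertible_delta_L:
  assumes R: "R \<in> Ob \<C>" and iso: "\<And>A. A \<in> Ob \<C> \<Longrightarrow> iso_arrow \<C> (delta_L \<C> A \<I> (ldual \<C> R))"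
  shows "dual_pair \<C> (\<I> \<bindnasrepma> ldual \<C> R) R"
proof (rule dual_pair_of_universal_right)
  let ?L = "\<I> \<bindnasrepma> ldual \<C> R" and ?R = "rdual \<C> (ldual \<C> R)"
  let ?e = "counit_r \<C> \<I> (ldual \<C> R) \<cdot> (\<one> ?L \<otimes>\<^sub>a bidual_rl \<C> R)"
  show "?L \<in> Ob \<C>" "R \<in> Ob \<C>" "?e \<in> hom \<C> (?L \<otimes> R) \<I>"
    using R by (simp_all add: in_hom_iff)
  fix A X assume o: "A \<in> Ob \<C>" "X \<in> Ob \<C>"
  obtain t where t: "t \<in> hom \<C> (A \<otimes> ?L) ((A \<otimes> \<I>) \<bindnasrepma> ldual \<C> ?R)"
    and counit: "counit_r \<C> (A \<otimes> \<I>) (ldual \<C> ?R) \<cdot> (t \<otimes>\<^sub>a bidual_rl \<C> ?R)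
      = (\<one> A \<otimes>\<^sub>a counit_r \<C> \<I> (ldual \<C> R)) \<cdot> assoc \<C> A ?L ?R"
    and delta: "delta_L \<C> A \<I> (ldual \<C> R) = (\<one> (A \<otimes> \<I>) \<bindnasrepma>\<^sub>a inv (bidual_lr \<C> (ldual \<C> R))) \<cdot> t"
    using delta_L_factor [of A \<I> "ldual \<C> R"] o R by auto
  have t': "t \<in> Arr \<C>" "Dom \<C> t = A \<otimes> ?L" "Cod \<C> t = (A \<otimes> \<I>) \<bindnasrepma> ldual \<C> ?R"
    using t by (auto simp: in_hom_iff)
  have "t = inv (\<one> (A \<otimes> \<I>) \<bindnasrepma>\<^sub>a inv (bidual_lr \<C> (ldual \<C> R))) \<cdot> delta_L \<C> A \<I> (ldual \<C> R)"
    unfolding delta using o R t' by simp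
  then have iso_t: "iso_arrow \<C> t"
    using iso [OF o(1)] o R by simp
  have "bij_betw (\<lambda>k. counit_r \<C> (A \<otimes> \<I>) (ldual \<C> ?R) \<cdot> ((t \<cdot> k) \<otimes>\<^sub>a bidual_rl \<C> ?R))
    (hom \<C> X (A \<otimes> ?L)) (hom \<C> (X \<otimes> ?R) (A \<otimes> \<I>))"
    by (rule bij_betw_trans [OF bij_betw_postcomp [OF iso_t t] transpose_r_bij, unfolded o_def])
      (use o R in auto)
  then have "bij_betw (\<lambda>k. (counit_r \<C> (A \<otimes> \<I>) (ldual \<C> ?R) \<cdot> ((t \<cdot> k) \<otimes>\<^sub>a bidual_rl \<C> ?R))
      \<cdot> (\<one> X \<otimes>\<^sub>a bidual_rl \<C> R)) (hom \<C> X (A \<otimes> ?L)) (hom \<C> (X \<otimes> R) (A \<otimes> \<I>))"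
    by (rule bij_betw_trans [OF _ bij_betw_precomp, unfolded o_def])
      (use o R in \<open>auto simp: in_hom_iff\<close>)
  moreover have "(counit_r \<C> (A \<otimes> \<I>) (ldual \<C> ?R) \<cdot> ((t \<cdot> k) \<otimes>\<^sub>a bidual_rl \<C> ?R)) \<cdot> (\<one> X \<otimes>\<^sub>a bidual_rl \<C> R)
    = (\<one> A \<otimes>\<^sub>a ?e) \<cdot> assoc \<C> A ?L R \<cdot> (k \<otimes>\<^sub>a \<one> R)" if "k \<in> hom \<C> X (A \<otimes> ?L)" for k
  proof -
    have k: "k \<in> Arr \<C>" "Dom \<C> k = X" "Cod \<C> k = A \<otimes> ?L"
      using that by (auto simp: in_hom_iff)
    have "(counit_r \<C> (A \<otimes> \<I>) (ldual \<C> ?R) \<cdot> ((t \<cdot> k) \<otimes>\<^sub>a bidual_rl \<C> ?R)) \<cdot> (\<one> X \<otimes>\<^sub>a bidual_rl \<C> R)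
      = (counit_r \<C> (A \<otimes> \<I>) (ldual \<C> ?R) \<cdot> (t \<otimes>\<^sub>a bidual_rl \<C> ?R)) \<cdot> (k \<otimes>\<^sub>a bidual_rl \<C> R)"
      using o R t' k by (simp add: interchange)
    also have "\<dots> = (\<one> A \<otimes>\<^sub>a counit_r \<C> \<I> (ldual \<C> R)) \<cdot> (assoc \<C> A ?L ?R
        \<cdot> (((\<one> A \<otimes>\<^sub>a \<one> ?L) \<otimes>\<^sub>a bidual_rl \<C> R) \<cdot> (k \<otimes>\<^sub>a \<one> R)))"
      unfolding counit using o R k by (simp add: interchange)
    also have "\<dots> = (\<one> A \<otimes>\<^sub>a ?e) \<cdot> assoc \<C> A ?L R \<cdot> (k \<otimes>\<^sub>a \<one> R)"
      using o R k by (simp add: assoc_nat_tail interchange_tail del: tensor_ident)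
    finally show ?thesis .
  qed
  ultimately show "bij_betw (\<lambda>k. (\<one> A \<otimes>\<^sub>a ?e) \<cdot> assoc \<C> A ?L R \<cdot> (k \<otimes>\<^sub>a \<one> R))
      (hom \<C> X (A \<otimes> ?L)) (hom \<C> (X \<otimes> R) (A \<otimes> \<I>))"
    by (rule bij_betw_cong [THEN iffD1, rotated])
qed

text \<open>The mirror image, for the right adjoint \<open>L\<^sup>\<bottom> \<bindnasrepma> -\<close> of \<open>L \<otimes> -\<close>.\<close>

lemma right_dual_of_invertible_delta_R:
  assumes L: "L \<in> Ob \<C>" and iso: "\<And>A. A \<in> Ob \<C> \<Longrightarrow> iso_arrow \<C> (delta_R \<C> (rdual \<C> L) \<I> A)"
  shows "dual_pair \<C> L (rdual \<C> L \<bindnasrepma> \<I>)"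
proof (rule dual_pair_of_universal_left)
  let ?R = "rdual \<C> L \<bindnasrepma> \<I>" and ?L = "ldual \<C> (rdual \<C> L)"
  let ?e = "counit_l \<C> (rdual \<C> L) \<I> \<cdot> (bidual_lr \<C> L \<otimes>\<^sub>a \<one> ?R)"
  show "?R \<in> Ob \<C>" "L \<in> Ob \<C>" "?e \<in> hom \<C> (L \<otimes> ?R) \<I>"
    using L by (simp_all add: in_hom_iff)
  fix A X assume o: "A \<in> Ob \<C>" "X \<in> Ob \<C>"
  obtain t where t: "t \<in> hom \<C> (?R \<otimes> A) (rdual \<C> ?L \<bindnasrepma> (\<I> \<otimes> A))"
    and counit: "counit_l \<C> (rdual \<C> ?L) (\<I> \<otimes> A) \<cdot> (bidual_lr \<C> ?L \<otimes>\<^sub>a t)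
      = (counit_l \<C> (rdual \<C> L) \<I> \<otimes>\<^sub>a \<one> A) \<cdot> inv (assoc \<C> ?L ?R A)"
    and delta: "delta_R \<C> (rdual \<C> L) \<I> A = (inv (bidual_rl \<C> (rdual \<C> L)) \<bindnasrepma>\<^sub>a \<one> (\<I> \<otimes> A)) \<cdot> t"
    using delta_R_factor [of "rdual \<C> L" \<I> A] o L by auto
  have t': "t \<in> Arr \<C>" "Dom \<C> t = ?R \<otimes> A" "Cod \<C> t = rdual \<C> ?L \<bindnasrepma> (\<I> \<otimes> A)"
    using t by (auto simp: in_hom_iff)
  have "t = inv (inv (bidual_rl \<C> (rdual \<C> L)) \<bindnasrepma>\<^sub>a \<one> (\<I> \<otimes> A)) \<cdot> delta_R \<C> (rdual \<C> L) \<I> A"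
    unfolding delta using o L t' by simp
  then have iso_t: "iso_arrow \<C> t"
    using iso [OF o(1)] o L by simp
  have "bij_betw (\<lambda>k. counit_l \<C> (rdual \<C> ?L) (\<I> \<otimes> A) \<cdot> (bidual_lr \<C> ?L \<otimes>\<^sub>a (t \<cdot> k)))
    (hom \<C> X (?R \<otimes> A)) (hom \<C> (?L \<otimes> X) (\<I> \<otimes> A))"
    by (rule bij_betw_trans [OF bij_betw_postcomp [OF iso_t t] transpose_l_bij, unfolded o_def])
      (use o L in auto)
  then have "bij_betw (\<lambda>k. (counit_l \<C> (rdual \<C> ?L) (\<I> \<otimes> A) \<cdot> (bidual_lr \<C> ?L \<otimes>\<^sub>a (t \<cdot> k)))
      \<cdot> (bidual_lr \<C> L \<otimes>\<^sub>a \<one> X)) (hom \<C> X (?R \<otimes> A)) (hom \<C> (L \<otimes> X) (\<I> \<otimes> A))"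
    by (rule bij_betw_trans [OF _ bij_betw_precomp, unfolded o_def])
      (use o L in \<open>auto simp: in_hom_iff\<close>)
  moreover have "(counit_l \<C> (rdual \<C> ?L) (\<I> \<otimes> A) \<cdot> (bidual_lr \<C> ?L \<otimes>\<^sub>a (t \<cdot> k))) \<cdot> (bidual_lr \<C> L \<otimes>\<^sub>a \<one> X)
    = (?e \<otimes>\<^sub>a \<one> A) \<cdot> inv (assoc \<C> L ?R A) \<cdot> (\<one> L \<otimes>\<^sub>a k)" if "k \<in> hom \<C> X (?R \<otimes> A)" for k
  proof -
    have k: "k \<in> Arr \<C>" "Dom \<C> k = X" "Cod \<C> k = ?R \<otimes> A"
      using that by (auto simp: in_hom_iff)
    have "(counit_l \<C> (rdual \<C> ?L) (\<I> \<otimes> A) \<cdot> (bidual_lr \<C> ?L \<otimes>\<^sub>a (t \<cdot> k))) \<cdot> (bidual_lr \<C> L \<otimes>\<^sub>a \<one> X)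
      = (counit_l \<C> (rdual \<C> ?L) (\<I> \<otimes> A) \<cdot> (bidual_lr \<C> ?L \<otimes>\<^sub>a t)) \<cdot> (bidual_lr \<C> L \<otimes>\<^sub>a k)"
      using o L t' k by (simp add: interchange)
    also have "\<dots> = (counit_l \<C> (rdual \<C> L) \<I> \<otimes>\<^sub>a \<one> A) \<cdot> ((inv (assoc \<C> ?L ?R A)
        \<cdot> (bidual_lr \<C> L \<otimes>\<^sub>a (\<one> ?R \<otimes>\<^sub>a \<one> A))) \<cdot> (\<one> L \<otimes>\<^sub>a k))"
      unfolding counit using o L k by (simp add: interchange)
    also have "\<dots> = (?e \<otimes>\<^sub>a \<one> A) \<cdot> inv (assoc \<C> L ?R A) \<cdot> (\<one> L \<otimes>\<^sub>a k)"
      using o L k by (simp add: inv_assoc_nat interchange_tail del: tensor_ident)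
    finally show ?thesis .
  qed
  ultimately show "bij_betw (\<lambda>k. (?e \<otimes>\<^sub>a \<one> A) \<cdot> inv (assoc \<C> L ?R A) \<cdot> (\<one> L \<otimes>\<^sub>a k))
      (hom \<C> X (?R \<otimes> A)) (hom \<C> (L \<otimes> X) (\<I> \<otimes> A))"
    by (rule bij_betw_cong [THEN iffD1, rotated])
qed


section \<open>The induced traces and the arrows Theta\<close>

text \<open>A pairing that is universal in its second variable identifies \<open>Q\<close> with \<open>P\<^sup>\<bottom>\<close>, by Yoneda; dualising this
  identification identifies \<open>P\<close> with \<open>\<^sup>\<bottom>Q\<close>.  It is needed because the isomorphism
  \<open>\<^sup>\<bottom>B \<otimes> \<^sup>\<bottom>A \<cong> \<^sup>\<bottom>(A \<bindnasrepma> B)\<close> is given as the transpose of such a pairing.\<close>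

lemma luntransp_iso:
  assumes P: "P \<in> Ob \<C>" and Q: "Q \<in> Ob \<C>" and h: "h \<in> hom \<C> (P \<otimes> Q) \<bottom>"
    and universal: "\<And>X. X \<in> Ob \<C> \<Longrightarrow>
      bij_betw (\<lambda>k. h \<cdot> (\<one> P \<otimes>\<^sub>a k)) (hom \<C> X Q) (hom \<C> (P \<otimes> X) \<bottom>)"
  shows "iso_arrow \<C> (luntransp \<C> Q P h)"
proof -
  define j where "j = runtransp \<C> P Q h"
  have j: "j \<in> hom \<C> Q (rdual \<C> P)" "ev_r \<C> P \<cdot> (\<one> P \<otimes>\<^sub>a j) = h"
    using P Q h by (simp_all add: j_def runtransp_simps)
  have j': "j \<in> Arr \<C>" "Dom \<C> j = Q" "Cod \<C> j = rdual \<C> P"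
    using j(1) by (auto simp: in_hom_iff)
  have "iso_arrow \<C> j"
  proof (rule iso_if_postcomp_bij [OF j(1)], rule bij_betw_factor [OF universal ev_r_universal_right])
    fix X k assume "X \<in> Ob \<C>" "k \<in> hom \<C> X Q"
    then show "ev_r \<C> P \<cdot> (\<one> P \<otimes>\<^sub>a (j \<cdot> k)) = h \<cdot> (\<one> P \<otimes>\<^sub>a k)"
      using P j' by (simp add: in_hom_iff interchange flip: j(2))
  qed (use P j' in \<open>auto simp: in_hom_iff\<close>)
  moreover have "luntransp \<C> Q P h = ldual_arr \<C> j \<cdot> bidual_lr \<C> P"
  proof (rule ev_l_cancel_left [of Q])
    have "ev_l \<C> Q \<cdot> ((ldual_arr \<C> j \<cdot> bidual_lr \<C> P) \<otimes>\<^sub>a \<one> Q)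
      = (ev_l \<C> Q \<cdot> (ldual_arr \<C> j \<otimes>\<^sub>a \<one> Q)) \<cdot> (bidual_lr \<C> P \<otimes>\<^sub>a \<one> Q)"
      using P Q j' by (simp add: interchange)
    also have "\<dots> = (ev_l \<C> (rdual \<C> P) \<cdot> (bidual_lr \<C> P \<otimes>\<^sub>a \<one> (rdual \<C> P))) \<cdot> (\<one> P \<otimes>\<^sub>a j)"
      using P Q j' by (simp add: ev_l_ldual_arr interchange)
    also have "\<dots> = h"
      using P j(2) by (simp only: ev_l_bidual_lr)
    finally show "ev_l \<C> Q \<cdot> (luntransp \<C> Q P h \<otimes>\<^sub>a \<one> Q)
      = ev_l \<C> Q \<cdot> ((ldual_arr \<C> j \<cdot> bidual_lr \<C> P) \<otimes>\<^sub>a \<one> Q)"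
      using P Q h by (simp add: luntransp_simps)
  qed (use P Q j' luntransp_simps(1) [OF Q h P] in \<open>auto simp: in_hom_iff\<close>)
  ultimately show ?thesis
    using P j' by simp
qed

lemma ldual_par_iso [simp]:
  assumes "A \<in> Ob \<C>" "B \<in> Ob \<C>"
  shows "iso_arrow \<C> (ldual_par \<C> A B)" "Dom \<C> (ldual_par \<C> A B) = ldual \<C> B \<otimes> ldual \<C> A"
    "Cod \<C> (ldual_par \<C> A B) = ldual \<C> (A \<bindnasrepma> B)"
proof -
  let ?P = "ldual \<C> B \<otimes> ldual \<C> A"
  define h where "h = ev_l \<C> B \<cdot> (\<one> (ldual \<C> B) \<otimes>\<^sub>a counit_l \<C> A B)
    \<cdot> assoc \<C> (ldual \<C> B) (ldual \<C> A) (A \<bindnasrepma> B)"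
  have h: "h \<in> hom \<C> (?P \<otimes> (A \<bindnasrepma> B)) \<bottom>"
    using assms by (simp add: h_def in_hom_iff)
  have u: "bij_betw (\<lambda>k. h \<cdot> (\<one> ?P \<otimes>\<^sub>a k)) (hom \<C> X (A \<bindnasrepma> B)) (hom \<C> (?P \<otimes> X) \<bottom>)"
    if X: "X \<in> Ob \<C>" for X
  proof -
    let ?c = "\<lambda>k. counit_l \<C> A B \<cdot> (\<one> (ldual \<C> A) \<otimes>\<^sub>a k)"
    have "bij_betw (\<lambda>k. ev_l \<C> B \<cdot> (\<one> (ldual \<C> B) \<otimes>\<^sub>a ?c k)) (hom \<C> X (A \<bindnasrepma> B))
      (hom \<C> (ldual \<C> B \<otimes> (ldual \<C> A \<otimes> X)) \<bottom>)"
      by (rule bij_betw_trans [OF counit_l_universal ev_l_universal_right, unfolded o_def])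
        (use assms X in auto)
    then have "bij_betw (\<lambda>k. (ev_l \<C> B \<cdot> (\<one> (ldual \<C> B) \<otimes>\<^sub>a ?c k)) \<cdot> assoc \<C> (ldual \<C> B) (ldual \<C> A) X)
      (hom \<C> X (A \<bindnasrepma> B)) (hom \<C> (?P \<otimes> X) \<bottom>)"
      by (rule bij_betw_trans [OF _ bij_betw_precomp, unfolded o_def])
        (use assms X in \<open>auto simp: in_hom_iff\<close>)
    moreover have "(ev_l \<C> B \<cdot> (\<one> (ldual \<C> B) \<otimes>\<^sub>a ?c k)) \<cdot> assoc \<C> (ldual \<C> B) (ldual \<C> A) X
      = h \<cdot> (\<one> ?P \<otimes>\<^sub>a k)" if "k \<in> hom \<C> X (A \<bindnasrepma> B)" for k
      using assms X that
        assoc_nat [of "\<one> (ldual \<C> B)" "\<one> (ldual \<C> A)" k "ldual \<C> B" "ldual \<C> A" "A \<bindnasrepma> B"]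
      by (simp add: h_def in_hom_iff interchange_tail)
    ultimately show ?thesis
      by (rule bij_betw_cong [THEN iffD1, rotated])
  qed
  have e: "ldual_par \<C> A B = luntransp \<C> (A \<bindnasrepma> B) ?P h"
    by (simp add: ldual_par_def h_def)
  show "iso_arrow \<C> (ldual_par \<C> A B)"
    unfolding e by (rule luntransp_iso [OF _ _ h u]) (use assms in auto)
  show "Dom \<C> (ldual_par \<C> A B) = ldual \<C> B \<otimes> ldual \<C> A"
    "Cod \<C> (ldual_par \<C> A B) = ldual \<C> (A \<bindnasrepma> B)"
    using luntransp_simps(1) [OF _ h] assms by (simp_all add: e in_hom_iff)
qed

lemma rdual_par_iso [simp]:
  assumes "A \<in> Ob \<C>" "B \<in> Ob \<C>"
  shows "iso_arrow \<C> (rdual_par \<C> A B)" "Dom \<C> (rdual_par \<C> A B) = rdual \<C> B \<otimes> rdual \<C> A"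
    "Cod \<C> (rdual_par \<C> A B) = rdual \<C> (A \<bindnasrepma> B)"
  using assms by (simp_all add: rdual_par_def par_ob_def)

lemma par_assoc_iso [simp]:
  assumes "A \<in> Ob \<C>" "B \<in> Ob \<C>" "C \<in> Ob \<C>"
  shows "iso_arrow \<C> (par_assoc \<C> A B C)" "Dom \<C> (par_assoc \<C> A B C) = (A \<bindnasrepma> B) \<bindnasrepma> C"
    "Cod \<C> (par_assoc \<C> A B C) = A \<bindnasrepma> (B \<bindnasrepma> C)"
  using assms by (simp_all add: par_assoc_def par_ob_def [of \<C> "A \<bindnasrepma> B" C] par_ob_def [of \<C> A "B \<bindnasrepma> C"])

lemma unit_rdual_bot_simps [simp]:
  "unit_rdual_bot \<C> \<in> Arr \<C>" "Dom \<C> (unit_rdual_bot \<C>) = \<I>" "Cod \<C> (unit_rdual_bot \<C>) = rdual \<C> \<bottom>"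
  using runtransp_simps(1) [of \<bottom> "runit \<C> \<bottom>" \<I>] by (simp_all add: unit_rdual_bot_def in_hom_iff)

lemma par_unit_simps [simp]:
  assumes "A \<in> Ob \<C>"
  shows "par_lunit \<C> A \<in> Arr \<C>" "Dom \<C> (par_lunit \<C> A) = \<bottom> \<bindnasrepma> A" "Cod \<C> (par_lunit \<C> A) = A"
    "par_runit \<C> A \<in> Arr \<C>" "Dom \<C> (par_runit \<C> A) = A \<bindnasrepma> \<bottom>" "Cod \<C> (par_runit \<C> A) = A"
  using assms by (simp_all add: par_lunit_def par_runit_def par_ob_def)

lemma par_trace_r_in_hom:
  assumes "left_trace \<C> TrL" "E \<in> Ob \<C>" "R \<in> Ob \<C>" "Z \<in> Ob \<C>" "f \<in> hom \<C> (E \<bindnasrepma> Z) (R \<bindnasrepma> Z)"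
  shows "par_trace_r \<C> TrL Z E R f \<in> hom \<C> E R"
proof -
  interpret tr: right_trace "reversed \<C>" TrL
    using assms(1) by (simp add: left_trace_def)
  let ?t = "TrL (rdual \<C> Z) (rdual \<C> R) (rdual \<C> E)
      (inv (rdual_par \<C> E Z) \<cdot> rdual_arr \<C> f \<cdot> rdual_par \<C> R Z)"
  have "?t \<in> hom \<C> (rdual \<C> R) (rdual \<C> E)"
    using tr.trace_in_hom [of "rdual \<C> R" "rdual \<C> E" "rdual \<C> Z"] assms by (simp add: in_hom_iff)
  from the_preimage_mem [OF rdual_arr_bij [OF assms(2,3)] this] show ?thesis
    by (simp only: par_trace_r_def)
qed

lemma par_trace_l_in_hom:
  assumes "right_trace \<C> TrR" "E \<in> Ob \<C>" "R \<in> Ob \<C>" "Z \<in> Ob \<C>" "f \<in> hom \<C> (Z \<bindnasrepma> E) (Z \<bindnasrepma> R)"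
  shows "par_trace_l \<C> TrR Z E R f \<in> hom \<C> E R"
proof -
  interpret tr: right_trace \<C> TrR
    by fact
  let ?t = "TrR (ldual \<C> Z) (ldual \<C> R) (ldual \<C> E)
      (inv (ldual_par \<C> Z E) \<cdot> ldual_arr \<C> f \<cdot> ldual_par \<C> Z R)"
  have "?t \<in> hom \<C> (ldual \<C> R) (ldual \<C> E)"
    using tr.trace_in_hom [of "ldual \<C> R" "ldual \<C> E" "ldual \<C> Z"] assms by (simp add: in_hom_iff)
  from the_preimage_mem [OF ldual_arr_bij [OF assms(2,3)] this] show ?thesis
    by (simp only: par_trace_l_def)
qed

text \<open>The equations assumed of \<open>Theta\<close> give inverse arrows only once \<open>Theta\<close> is known to be an arrow with the
  right ends; for this each intermediate arrow, and each trace, has to be typed.\<close>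

lemma Theta_in_hom:
  assumes "right_trace \<C> TrR" "left_trace \<C> TrL"
    and o: "A \<in> Ob \<C>" "B \<in> Ob \<C>" "C \<in> Ob \<C>" "D \<in> Ob \<C>" "X \<in> Ob \<C>"
    and f: "f \<in> hom \<C> (A \<bindnasrepma> X) C" and g: "g \<in> hom \<C> B (X \<otimes> D)"
  shows "Theta \<C> TrR TrL A B C D X f g \<in> hom \<C> (A \<bindnasrepma> B) (C \<otimes> D)"
proof -
  interpret tr: right_trace \<C> TrR
    by fact
  have "theta_inner \<C> TrR B D X g \<in> hom \<C> (B \<bindnasrepma> ldual \<C> D) X"
    unfolding theta_inner_def by (rule tr.trace_in_hom) (use o g in \<open>auto simp: in_hom_iff\<close>)
  then show ?thesis
    unfolding Theta_def by (intro par_trace_r_in_hom assms(2)) (use o f in \<open>auto simp: in_hom_iff\<close>)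
qed

lemma Theta'_in_hom:
  assumes "right_trace \<C> TrR" "left_trace \<C> TrL"
    and o: "A \<in> Ob \<C>" "B \<in> Ob \<C>" "C \<in> Ob \<C>" "D \<in> Ob \<C>" "X \<in> Ob \<C>"
    and f: "f \<in> hom \<C> (X \<bindnasrepma> A) C" and g: "g \<in> hom \<C> B (D \<otimes> X)"
  shows "Theta' \<C> TrR TrL A B C D X f g \<in> hom \<C> (B \<bindnasrepma> A) (D \<otimes> C)"
proof -
  interpret tr: right_trace "reversed \<C>" TrL
    using assms(2) by (simp add: left_trace_def)
  let ?h = "par_lunit \<C> (D \<otimes> X) \<cdot> (ev_r \<C> D \<bindnasrepma>\<^sub>a \<one> (D \<otimes> X)) \<cdot> delta_L \<C> D (rdual \<C> D) (D \<otimes> X)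
    \<cdot> (\<one> D \<otimes>\<^sub>a (\<one> (rdual \<C> D) \<bindnasrepma>\<^sub>a g))"
  have "theta_inner' \<C> TrL B D X g \<in> hom \<C> (rdual \<C> D \<bindnasrepma> B) X"
    unfolding theta_inner'_def using tr.trace_in_hom [of "rdual \<C> D \<bindnasrepma> B" X D ?h] o g
    by (auto simp: in_hom_iff)
  then show ?thesis
    unfolding Theta'_def by (intro par_trace_l_in_hom assms(1)) (use o f in \<open>auto simp: in_hom_iff\<close>)
qed

end


section \<open>Autonomy\<close>

theorem proposition4:
  fixes \<C> :: "('o, 'm, 'z) star_data_scheme" (structure)
    and TrR TrL :: "'o \<Rightarrow> 'o \<Rightarrow> 'o \<Rightarrow> 'm \<Rightarrow> 'm"
  assumes star_autonomous: "star_autonomous_category \<C>"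
    and cauchy_complete: "cauchy_complete \<C>"
    and right_tensor_trace: "right_trace \<C> TrR"
    and left_tensor_trace: "left_trace \<C> TrL"
    and eps_tensor_sup: "\<And>A B C D P Q k g h. \<lbrakk>
      A \<in> Ob \<C>; B \<in> Ob \<C>; C \<in> Ob \<C>; D \<in> Ob \<C>; P \<in> Ob \<C>; Q \<in> Ob \<C>;
      k \<in> hom \<C> A C; g \<in> hom \<C> B (P \<otimes> Q); h \<in> hom \<C> (P \<otimes> Q) D\<rbrakk> \<Longrightarrow>
      (\<one> C \<bindnasrepma>\<^sub>a h) \<cdot> delta_R \<C> C P Q \<cdot> Theta \<C> TrR TrL A B (C \<bindnasrepma> P) Q P (k \<bindnasrepma>\<^sub>a \<one> P) g
        = k \<bindnasrepma>\<^sub>a (h \<cdot> g)"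
    and eps_par_sup: "\<And>B C D E P Q k p q. \<lbrakk>
      B \<in> Ob \<C>; C \<in> Ob \<C>; D \<in> Ob \<C>; E \<in> Ob \<C>; P \<in> Ob \<C>; Q \<in> Ob \<C>;
      k \<in> hom \<C> B D; p \<in> hom \<C> E (P \<bindnasrepma> Q); q \<in> hom \<C> (P \<bindnasrepma> Q) C\<rbrakk> \<Longrightarrow>
      Theta \<C> TrR TrL P (Q \<otimes> B) C D Q q (\<one> Q \<otimes>\<^sub>a k) \<cdot> delta_R \<C> P Q B \<cdot> (p \<otimes>\<^sub>a \<one> B)
        = (q \<cdot> p) \<otimes>\<^sub>a k"
    and eps_tensor_sup': "\<And>A B C D P Q k g h. \<lbrakk>
      A \<in> Ob \<C>; B \<in> Ob \<C>; C \<in> Ob \<C>; D \<in> Ob \<C>; P \<in> Ob \<C>; Q \<in> Ob \<C>;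
      k \<in> hom \<C> A C; g \<in> hom \<C> B (Q \<otimes> P); h \<in> hom \<C> (Q \<otimes> P) D\<rbrakk> \<Longrightarrow>
      (h \<bindnasrepma>\<^sub>a \<one> C) \<cdot> delta_L \<C> Q P C \<cdot> Theta' \<C> TrR TrL A B (P \<bindnasrepma> C) Q P (\<one> P \<bindnasrepma>\<^sub>a k) g
        = (h \<cdot> g) \<bindnasrepma>\<^sub>a k"
    and eps_par_sup': "\<And>B C D E P Q k p q. \<lbrakk>
      B \<in> Ob \<C>; C \<in> Ob \<C>; D \<in> Ob \<C>; E \<in> Ob \<C>; P \<in> Ob \<C>; Q \<in> Ob \<C>;
      k \<in> hom \<C> B D; p \<in> hom \<C> E (Q \<bindnasrepma> P); q \<in> hom \<C> (Q \<bindnasrepma> P) C\<rbrakk> \<Longrightarrow>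
      Theta' \<C> TrR TrL P (B \<otimes> Q) C D Q q (k \<otimes>\<^sub>a \<one> Q) \<cdot> delta_L \<C> B Q P \<cdot> (\<one> B \<otimes>\<^sub>a p)
        = k \<otimes>\<^sub>a (q \<cdot> p)"
  shows "autonomous \<C>"
proof -
  interpret star_autonomous_category \<C>
    by fact
  \<comment> \<open>The same arrow \<open>Theta(1, 1)\<close> occurs in both equations: as a section of the distributor in
    the first and as a retraction in the second.\<close>
  have iso_R: "iso_arrow \<C> (delta_R \<C> A P Q)" if o: "A \<in> Ob \<C>" "P \<in> Ob \<C>" "Q \<in> Ob \<C>" for A P Q
  proof -
    let ?T = "Theta \<C> TrR TrL A (P \<otimes> Q) (A \<bindnasrepma> P) Q P (\<one> (A \<bindnasrepma> P)) (\<one> (P \<otimes> Q))"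
    have T: "?T \<in> hom \<C> (A \<bindnasrepma> (P \<otimes> Q)) ((A \<bindnasrepma> P) \<otimes> Q)"
      by (rule Theta_in_hom [OF right_tensor_trace left_tensor_trace]) (use o in \<open>auto simp: in_hom_iff\<close>)
    have "delta_R \<C> A P Q \<cdot> ?T = \<one> (A \<bindnasrepma> (P \<otimes> Q))"
      using eps_tensor_sup [of A "P \<otimes> Q" A "P \<otimes> Q" P Q "\<one> A" "\<one> (P \<otimes> Q)" "\<one> (P \<otimes> Q)"] o
      by (simp add: in_hom_iff)
    moreover have "?T \<cdot> delta_R \<C> A P Q = \<one> ((A \<bindnasrepma> P) \<otimes> Q)"
      using eps_par_sup [of Q "A \<bindnasrepma> P" Q "A \<bindnasrepma> P" A P "\<one> Q" "\<one> (A \<bindnasrepma> P)" "\<one> (A \<bindnasrepma> P)"] o T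
      by (simp add: in_hom_iff)
    ultimately show ?thesis
      using inverse_arrow_eq(1) [OF _ T] o by (simp add: in_hom_iff)
  qed
  have iso_L: "iso_arrow \<C> (delta_L \<C> Q P A)" if o: "A \<in> Ob \<C>" "P \<in> Ob \<C>" "Q \<in> Ob \<C>" for A P Q
  proof -
    let ?T = "Theta' \<C> TrR TrL A (Q \<otimes> P) (P \<bindnasrepma> A) Q P (\<one> (P \<bindnasrepma> A)) (\<one> (Q \<otimes> P))"
    have T: "?T \<in> hom \<C> ((Q \<otimes> P) \<bindnasrepma> A) (Q \<otimes> (P \<bindnasrepma> A))"
      by (rule Theta'_in_hom [OF right_tensor_trace left_tensor_trace]) (use o in \<open>auto simp: in_hom_iff\<close>)
    have "delta_L \<C> Q P A \<cdot> ?T = \<one> ((Q \<otimes> P) \<bindnasrepma> A)"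
      using eps_tensor_sup' [of A "Q \<otimes> P" A "Q \<otimes> P" P Q "\<one> A" "\<one> (Q \<otimes> P)" "\<one> (Q \<otimes> P)"] o
      by (simp add: in_hom_iff)
    moreover have "?T \<cdot> delta_L \<C> Q P A = \<one> (Q \<otimes> (P \<bindnasrepma> A))"
      using eps_par_sup' [of Q "P \<bindnasrepma> A" Q "P \<bindnasrepma> A" A P "\<one> Q" "\<one> (P \<bindnasrepma> A)" "\<one> (P \<bindnasrepma> A)"] o T
      by (simp add: in_hom_iff)
    ultimately show ?thesis
      using inverse_arrow_eq(1) [OF _ T] o by (simp add: in_hom_iff)
  qed
  show ?thesis
    unfolding autonomous_def
    using left_dual_of_invertible_delta_L [OF _ iso_L] right_dual_of_invertible_delta_R [OF _ iso_R] by auto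
qed

end
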